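(* Let $k\ge 2$ be an integer and let $G$ be a connected graph of order $n\ge n_1(k)$. If $\delta(G)\ge 2k$ and $NC(G)\ge \frac{n-2}{2}$, then $G$ has a $[2,k]$-ST.
   Context: All graphs are finite and simple. $\delta(G)$ is the minimum degree of $G$. For a graph $G$ that is not complete, $NC(G)=\min\{|N_G(u)\cup N_G(v)| : u,v\in V(G),\ u\ne v,\ uv\notin E(G)\}$, where $N_G(x)$ is the set of neighbours of $x$ (this quantity is defined only for non-complete graphs). For an integer $k\ge 2$, a $[2,k]$-ST of a connected graph $G$ is a spanning tree $T$ of $G$ having no vertex whose degree in $T$ lies in $\{2,3,\dots,k\}$. Let $c_k=(\sqrt{k}+\sqrt{2})\sqrt{k(k-1)}$, and let $n_1(k)$ be the smallest positive integer such that $n-4c_k\sqrt{n}-12k+14\ge 0$ holds for every integer $n\ge n_1(k)$. *)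

theory Defs
  imports Complex_Main "Graph_Theory.Graph_Theory"
begin

text \<open>
  A finite simple graph is a \<^locale>\<open>pair_graph\<close>: a finite vertex set with a symmetric,
  irreflexive set of ordered pairs, so each edge \<open>uv\<close> is the two arcs \<open>(u, v)\<close> and \<open>(v, u)\<close>.
  Consequently the degree of a vertex is its out-degree, and complete graphs are those
  satisfying the library predicate \<^const>\<open>complete_digraph\<close>.
\<close>

definition nbhd :: "'a pair_pre_digraph \<Rightarrow> 'a \<Rightarrow> 'a set" where
  "nbhd G u = {v. (u, v) \<in> parcs G}"

abbreviation degree :: "'a pair_pre_digraph \<Rightarrow> 'a \<Rightarrow> nat" where
  "degree G v \<equiv> out_degree (with_proj G) v"

definition min_degree :: "'a pair_pre_digraph \<Rightarrow> nat" where
  "min_degree G = Min (degree G ` pverts G)"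

abbreviation complete_graph :: "'a pair_pre_digraph \<Rightarrow> bool" where
  "complete_graph G \<equiv> complete_digraph (card (pverts G)) (with_proj G)"

text \<open>Meaningful only for non-complete graphs; otherwise the minimum is over the empty set.\<close>
definition NC :: "'a pair_pre_digraph \<Rightarrow> nat" where
  "NC G = Min {card (nbhd G u \<union> nbhd G v) | u v.
     u \<in> pverts G \<and> v \<in> pverts G \<and> u \<noteq> v \<and> (u, v) \<notin> parcs G}"

text \<open>
  The library's \<^const>\<open>forest\<close> and \<^const>\<open>spanning_tree\<close> refer to directed cycles. They reject
  every symmetric digraph with an edge, since \<open>u, v, u\<close> counts as a cycle there, and accept
  orientations of graphs that do have cycles. In a simple undirected graph the cycles are
  exactly the library cycles of length at least 3.
\<close>
definition is_tree :: "'a pair_pre_digraph \<Rightarrow> bool" where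
  "is_tree T \<longleftrightarrow> pair_graph T \<and> Digraph_Component.connected (with_proj T) \<and>
     \<not> (\<exists>p. pre_digraph.cycle (with_proj T) p \<and> length p \<ge> 3)"

definition is_spanning_tree :: "'a pair_pre_digraph \<Rightarrow> 'a pair_pre_digraph \<Rightarrow> bool" where
  "is_spanning_tree T G \<longleftrightarrow> is_tree T \<and> spanning (with_proj T) (with_proj G)"

text \<open>\<open>T\<close> is a \<open>[2,k]\<close>-ST of \<open>G\<close>.\<close>
definition is_2k_ST :: "nat \<Rightarrow> 'a pair_pre_digraph \<Rightarrow> 'a pair_pre_digraph \<Rightarrow> bool" where
  "is_2k_ST k T G \<longleftrightarrow> is_spanning_tree T G \<and> (\<forall>v \<in> pverts T. degree T v \<notin> {2..k})"

definition c_const :: "nat \<Rightarrow> real" where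
  "c_const k = (sqrt (real k) + sqrt 2) * sqrt (real k * (real k - 1))"

definition n1 :: "nat \<Rightarrow> nat" where
  "n1 k = (LEAST m. m > 0 \<and>
     (\<forall>n\<ge>m. real n - 4 * c_const k * sqrt (real n) - 12 * real k + 14 \<ge> 0))"

text \<open>The set whose least element is \<^const>\<open>n1\<close> is nonempty.\<close>
lemma n1_ex: "\<exists>m>0. \<forall>n\<ge>m. real n - 4 * c_const k * sqrt (real n) - 12 * real k + 14 \<ge> 0"
proof -
  define d where "d = \<bar>4 * c_const k\<bar> + 12 * real k + 1"
  have "real n - 4 * c_const k * sqrt (real n) - 12 * real k + 14 \<ge> 0"
    if "n \<ge> nat \<lceil>d\<^sup>2\<rceil> + 1" for n
  proof -
    have "d\<^sup>2 \<le> real n" using that by linarith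
    then have s: "d \<le> sqrt (real n)" by (rule real_le_rsqrt)
    have "d \<ge> 1" by (simp add: d_def)
    then have "d * sqrt (real n) \<le> sqrt (real n) * sqrt (real n)"
      by (intro mult_right_mono s) simp
    then have a: "d * sqrt (real n) \<le> real n" by simp
    have b: "12 * real k * 1 \<le> 12 * real k * sqrt (real n)"
      using order_trans[OF \<open>d \<ge> 1\<close> s] by (intro mult_left_mono) auto
    have e: "4 * c_const k * sqrt (real n) \<le> \<bar>4 * c_const k\<bar> * sqrt (real n)"
      by (intro mult_right_mono) auto
    have "d * sqrt (real n) =
        \<bar>4 * c_const k\<bar> * sqrt (real n) + 12 * real k * sqrt (real n) + sqrt (real n)"
      by (simp add: d_def algebra_simps)
    moreover have "sqrt (real n) \<ge> 0" by simp
    ultimately show ?thesis using a b e by linarith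
  qed
  then show ?thesis by (intro exI[of _ "nat \<lceil>d\<^sup>2\<rceil> + 1"]) simp
qed

end

(*
  Call a vertex low if its degree is below (n - 2)/4. Two low vertices are adjacent, since
  otherwise the union of their neighbourhoods would be too small, and the graph induced on the
  high vertices has at most two components, because each component contains at least n/2 - d(x)
  vertices outside the neighbourhood of a low vertex x. Hence the high vertices become connected
  after adding at most two low ones, and a greedy choice among high vertices extends these to a
  connected dominating set D with |D| <= 11 + 4 ln n. Take a spanning tree whose inner vertices
  lie in D. The condition n >= n1(k) gives k |D| < (n - 2)/4, so a vertex of D of tree degree at
  most k has a neighbour that can be moved to it from a parent with an edge to spare; the low
  vertices of D receive k + 1 tree neighbours at the start, thanks to the minimum degree 2k.
*)
theory Submission
  imports Defs
begin

section \<open>Spanning trees given by parent functions\<close>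

text \<open>Moving neighbours repairs a vertex of \<open>D\<close> only if it has more than
  \<open>k * card D\<close> neighbours, and the minimum degree guarantees a low vertex only
  \<open>2 * k\<close>. So low vertices enter \<open>D\<close> solely as connectors, their tree
  degrees are fixed in a starting tree before anything else is attached, and the later exchanges
  preserve that lower bound. All further vertices of \<open>D\<close> have to be high. High degree
  alone does not give many high neighbours, but a vertex not adjacent to a low connector has at
  least \<open>n / 4\<close> high vertices in its closed neighbourhood, and those are the only
  vertices still to be dominated. The logarithm comes from greedy covering: with \<open>u\<close>
  vertices undominated, each added vertex covers on average at least
  \<open>u * n / (8 * u + 4 * n)\<close> of them. Integrating the reciprocal of this rate gives
  \<open>8 * u / n + 4 * ln u\<close>, at most \<open>8 + 4 * ln n\<close>; two connectors and one
  closing vertex make it \<open>11 + 4 * ln n\<close>. The condition on \<open>n1\<close> is used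
  through the quadratic bound \<open>n >= 69 * k^2\<close>, strong enough against
  \<open>k * ln n\<close>.\<close>

lemma rtrancl_on_crossing:
  assumes "(a, b) \<in> rtrancl_on F R" "a \<in> P" "b \<notin> P"
  obtains u v where "(u, v) \<in> R" "u \<in> F \<inter> P" "v \<in> F - P"
proof -
  have "b \<in> P \<or> (\<exists>u v. (u, v) \<in> R \<and> u \<in> F \<inter> P \<and> v \<in> F - P)"
    using assms(1) by (induct rule: rtrancl_on_induct) (use assms(2) in auto)
  with assms(3) that show thesis by blast
qed

context pair_graph
begin

lemma nbhd_iff: "v \<in> nbhd G u \<longleftrightarrow> (u, v) \<in> parcs G"
  by (simp add: nbhd_def)

lemma nbhd_commute: "v \<in> nbhd G u \<longleftrightarrow> u \<in> nbhd G v"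
  by (auto simp: nbhd_def intro: arcs_symmetric)

lemma nbhd_subset: "nbhd G u \<subseteq> pverts G"
  by (auto simp: nbhd_def dest: in_arcsD2)

lemma finite_nbhd [simp]: "finite (nbhd G u)"
  using nbhd_subset pair_finite_verts by (rule finite_subset)

lemma nbhd_irrefl [simp]: "v \<notin> nbhd G v"
  using no_loops' by (auto simp: nbhd_def)

lemma degree_eq_card_nbhd: "degree G v = card (nbhd G v)"
proof -
  have "out_arcs (with_proj G) v = Pair v ` nbhd G v"
    by (auto simp: nbhd_def)
  then show ?thesis
    by (simp add: out_degree_def card_image inj_on_def)
qed

text \<open>
  A tree on the vertex set \<open>A\<close> with root \<open>r\<close>, all of whose inner vertices lie in \<open>D\<close>. The
  condition on \<open>h\<close> forces every orbit of \<open>p\<close> to end in \<open>r\<close>.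
\<close>
definition ptree :: "'a set \<Rightarrow> 'a \<Rightarrow> ('a \<Rightarrow> 'a) \<Rightarrow> 'a set \<Rightarrow> bool" where
  "ptree D r p A \<longleftrightarrow> r \<in> A \<inter> D \<and> A \<subseteq> pverts G \<and> p r = r \<and>
     (\<forall>v\<in>A - {r}. p v \<in> A \<inter> D \<inter> nbhd G v) \<and>
     (\<exists>h::'a \<Rightarrow> nat. \<forall>v\<in>A - {r}. h (p v) < h v)"

text \<open>\<open>r\<close> is excluded because \<open>p r = r\<close> would make the root its own
  child.\<close>

definition children :: "'a set \<Rightarrow> 'a \<Rightarrow> ('a \<Rightarrow> 'a) \<Rightarrow> 'a \<Rightarrow> 'a set" where
  "children A r p v = {w \<in> A - {r}. p w = v}"

definition tdeg :: "'a set \<Rightarrow> 'a \<Rightarrow> ('a \<Rightarrow> 'a) \<Rightarrow> 'a \<Rightarrow> nat" where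
  "tdeg A r p v = card (children A r p v) + (if v = r then 0 else 1)"

lemma finite_children [simp]: "finite A \<Longrightarrow> finite (children A r p v)"
  by (simp add: children_def)

lemma ptreeI:
  fixes h :: "'a \<Rightarrow> nat"
  assumes "r \<in> A \<inter> D" "A \<subseteq> pverts G" "p r = r"
    and "\<And>v. v \<in> A \<Longrightarrow> v \<noteq> r \<Longrightarrow> p v \<in> A \<inter> D \<inter> nbhd G v"
    and "\<And>v. v \<in> A \<Longrightarrow> v \<noteq> r \<Longrightarrow> h (p v) < h v"
  shows "ptree D r p A"
  unfolding ptree_def using assms by blast

lemma ptree_parent:
  assumes "ptree D r p A" "v \<in> A" "v \<noteq> r"
  shows "p v \<in> A" "p v \<in> D" "p v \<in> nbhd G v"
  using assms by (simp_all add: ptree_def)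

lemma ptree_reaches_root:
  assumes "ptree D r p A" "v \<in> A"
  shows "\<exists>i. (p ^^ i) v = r"
proof -
  from assms(1) obtain h :: "'a \<Rightarrow> nat" where h: "\<forall>v\<in>A - {r}. h (p v) < h v"
    unfolding ptree_def by blast
  show ?thesis using assms(2)
  proof (induct "h v" arbitrary: v rule: less_induct)
    case less
    show ?case
    proof (cases "v = r")
      case True
      then show ?thesis by (intro exI[of _ 0]) simp
    next
      case False
      then have "p v \<in> A" "h (p v) < h v" using assms(1) h less.prems unfolding ptree_def by auto
      then obtain i where "(p ^^ i) (p v) = r" using less.hyps by blast
      then have "(p ^^ Suc i) v = r" by (simp add: funpow_swap1)
      then show ?thesis by blast
    qed
  qed
qed

lemma ptree_orbit:
  assumes "ptree D r p A" "v \<in> A"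
  shows "(p ^^ i) v \<in> A"
proof (induct i)
  case (Suc i)
  then show ?case using assms(1) unfolding ptree_def by (cases "(p ^^ i) v = r") auto
qed (use assms in simp)

lemma ptree_reattach:
  assumes T: "ptree D r p A" and c: "c \<in> A \<inter> D" and w: "w \<in> A" "w \<in> nbhd G c"
    and anc: "\<And>i. (p ^^ i) c \<noteq> w"
  shows "ptree D r (p(w := c)) A"
proof -
  from T obtain h :: "'a \<Rightarrow> nat" where h: "\<forall>v\<in>A - {r}. h (p v) < h v"
    unfolding ptree_def by blast
  obtain i where "(p ^^ i) c = r" using ptree_reaches_root[OF T] c by blast
  with anc have wr: "w \<noteq> r" by blast
  define desc where "desc u \<longleftrightarrow> (\<exists>i. (p ^^ i) u = w)" for u
  \<comment> \<open>\<open>c\<close> is not below \<open>w\<close>, so lifting the whole subtree of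
    \<open>w\<close> above \<open>c\<close> keeps every old descent and creates the one from
    \<open>w\<close> to \<open>c\<close>.\<close>
  define h' where "h' u = (if desc u then h u + h c + 1 else h u)" for u
  have step: "desc (p u) \<longleftrightarrow> desc u" if uw: "u \<noteq> w" for u
  proof
    assume "desc (p u)"
    then obtain i where "(p ^^ i) (p u) = w" by (auto simp: desc_def)
    then have "(p ^^ Suc i) u = w" by (simp add: funpow_swap1)
    then show "desc u" unfolding desc_def by blast
  next
    assume "desc u"
    then obtain i where i: "(p ^^ i) u = w" by (auto simp: desc_def)
    then obtain j where "i = Suc j" using uw by (cases i) auto
    with i show "desc (p u)" unfolding desc_def by (auto simp: funpow_swap1)
  qed
  have "desc w" unfolding desc_def by (rule exI[of _ 0]) simp
  moreover have "\<not> desc c" using anc by (simp add: desc_def)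
  ultimately have "h' c < h' w" by (simp add: h'_def)
  moreover have "h' (p u) < h' u" if "u \<in> A - {r}" "u \<noteq> w" for u
    using h that step[OF that(2)] by (auto simp: h'_def)
  ultimately have h': "h' ((p(w := c)) v) < h' v" if "v \<in> A" "v \<noteq> r" for v
    using that by simp
  have "c \<in> nbhd G w" using w(2) nbhd_commute by blast
  then show ?thesis
    by (intro ptreeI[where h = h'] h') (use T c wr in \<open>auto simp: ptree_def\<close>)
qed

lemma ptree_insert:
  assumes T: "ptree D r p A" and v: "v \<in> pverts G - A" and d: "d \<in> A \<inter> D" "d \<in> nbhd G v"
  shows "ptree D r (p(v := d)) (insert v A)"
proof -
  from T obtain h :: "'a \<Rightarrow> nat" where h: "\<forall>v\<in>A - {r}. h (p v) < h v"
    unfolding ptree_def by blast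
  show ?thesis
  proof (rule ptreeI[where h = "h(v := Suc (h d))"])
    fix u assume "u \<in> insert v A" "u \<noteq> r"
    then show "(p(v := d)) u \<in> insert v A \<inter> D \<inter> nbhd G u"
      "(h(v := Suc (h d))) ((p(v := d)) u) < (h(v := Suc (h d))) u"
      using h T v d unfolding ptree_def by auto
  qed (use T v d in \<open>auto simp: ptree_def\<close>)
qed

text \<open>While \<open>D\<close> is not exhausted, a path inside \<open>D\<close> leaves the tree
  along an arc whose tail can serve as parent; afterwards domination supplies a parent in
  \<open>D\<close> for every other vertex. Old parents are kept, so tree degrees never drop.\<close>

lemma ptree_extend:
  assumes "ptree D r p A"
    and D: "D \<subseteq> pverts G" "\<And>d. d \<in> D \<Longrightarrow> (r, d) \<in> rtrancl_on D (parcs G)"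
    and dom: "\<And>v. v \<in> pverts G - D \<Longrightarrow> nbhd G v \<inter> D \<noteq> {}"
  shows "\<exists>q. ptree D r q (pverts G) \<and> (\<forall>v\<in>A. q v = p v)"
  using assms(1)
proof (induct "card (pverts G - A)" arbitrary: p A rule: less_induct)
  case less
  have r: "r \<in> A \<inter> D" "A \<subseteq> pverts G" using less.prems unfolding ptree_def by auto
  show ?case
  proof (cases "A = pverts G")
    case True
    then show ?thesis using less.prems by blast
  next
    case False
    have "\<exists>v d. v \<in> pverts G - A \<and> d \<in> A \<inter> D \<and> d \<in> nbhd G v"
    proof (cases "D \<subseteq> A")
      case True
      obtain v where "v \<in> pverts G - A" using False r by blast
      then show ?thesis using dom[of v] True by blast
    next
      case False
      then obtain d where d: "d \<in> D" "d \<notin> A" by blast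
      obtain u v where "(u, v) \<in> parcs G" "u \<in> D \<inter> A" "v \<in> D - A"
        using rtrancl_on_crossing[OF D(2)[OF d(1)] _ d(2)] r by blast
      then show ?thesis using D(1) nbhd_commute nbhd_iff by blast
    qed
    then obtain v d where v: "v \<in> pverts G - A" "d \<in> A \<inter> D" "d \<in> nbhd G v" by blast
    have "card (pverts G - insert v A) < card (pverts G - A)"
      using v(1) pair_finite_verts by (intro psubset_card_mono) auto
    from less.hyps[OF this ptree_insert[OF less.prems v]]
    obtain q where "ptree D r q (pverts G)" "\<forall>u\<in>insert v A. q u = (p(v := d)) u" by blast
    then show ?thesis using v(1) by auto
  qed
qed

text \<open>Each neighbour of \<open>c\<close> is charged to a vertex of \<open>D\<close>: a
  non-ancestor to its parent, an ancestor to itself. An ancestor other than \<open>c\<close> gains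
  itself but loses its child on the path to \<open>c\<close>, which is an ancestor too. Hence
  \<open>B q\<close> has at most \<open>k\<close> elements, except that the root, having no parent
  edge, may receive \<open>k + 1\<close>.\<close>

lemma card_nbhd_le_of_deficient:
  assumes T: "ptree D r p (pverts G)" and D: "D \<subseteq> pverts G" and k: "k \<ge> 1"
    and c: "c \<in> D" "tdeg (pverts G) r p c \<le> k"
    and tight: "\<And>w. w \<in> nbhd G c \<Longrightarrow> (\<And>i. (p ^^ i) c \<noteq> w) \<Longrightarrow> tdeg (pverts G) r p (p w) \<le> k + 1"
  shows "card (nbhd G c) \<le> k * card D"
proof -
  let ?ch = "children (pverts G) r p" and ?deg = "tdeg (pverts G) r p"
  define Anc where "Anc = {(p ^^ i) c | i. True}"
  define B where "B q = (if ?deg q \<le> k + 1 then ?ch q - Anc else {}) \<union> (if q \<in> Anc - {c} then {q} else {})" for q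
  have fin: "finite D" using D pair_finite_verts by (rule finite_subset)
  have finB: "finite (B q)" for q using pair_finite_verts by (simp add: B_def)
  have rD: "r \<in> D" using T by (auto simp: ptree_def)
  have rAnc: "r \<in> Anc" using ptree_reaches_root[OF T, of c] c D by (auto simp: Anc_def)
  have AncD: "q \<in> D" if "q \<in> Anc" for q
  proof -
    from that obtain i where i: "q = (p ^^ i) c" by (auto simp: Anc_def)
    show ?thesis
    proof (cases i)
      case 0
      then show ?thesis using i c by simp
    next
      case (Suc j)
      have "(p ^^ j) c \<in> pverts G" using ptree_orbit[OF T] c D by blast
      then show ?thesis using T i Suc unfolding ptree_def by (cases "(p ^^ j) c = r") auto
    qed
  qed
  have "nbhd G c \<subseteq> (\<Union>q\<in>D. B q)"
  proof
    fix w assume w: "w \<in> nbhd G c"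
    then have wc: "w \<noteq> c" and wV: "w \<in> pverts G" using nbhd_subset by auto
    show "w \<in> (\<Union>q\<in>D. B q)"
    proof (cases "w \<in> Anc")
      case True
      then have "w \<in> B w" using wc by (simp add: B_def)
      then show ?thesis using AncD[OF True] by blast
    next
      case False
      then have "w \<noteq> r" using rAnc by blast
      then have "p w \<in> D" "w \<in> ?ch (p w)" using T wV by (auto simp: ptree_def children_def)
      moreover have "?deg (p w) \<le> k + 1" using tight[OF w] False by (auto simp: Anc_def)
      ultimately show ?thesis using False by (auto simp: B_def)
    qed
  qed
  then have "card (nbhd G c) \<le> card (\<Union>q\<in>D. B q)"
    using fin finB by (intro card_mono) auto
  also have "\<dots> \<le> (\<Sum>q\<in>D. card (B q))" using fin by (rule card_UN_le)
  finally have le: "card (nbhd G c) \<le> (\<Sum>q\<in>D. card (B q))" .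
  have ch_le: "card (?ch q - Anc) \<le> card (?ch q)" for q
    using pair_finite_verts by (intro card_mono) auto
  have Bc: "card (B c) + (if c = r then 0 else 1) \<le> k"
    using c(2) ch_le[of c] by (auto simp: B_def tdeg_def)
  have Bq: "card (B q) \<le> (if q = r then k + 1 else k)" if qc: "q \<noteq> c" for q
  proof (cases "q \<in> Anc")
    case False
    then show ?thesis using ch_le[of q] rAnc by (auto simp: B_def tdeg_def)
  next
    case True
    then have ex: "\<exists>i. (p ^^ i) c = q" by (auto simp: Anc_def)
    define i where "i = (LEAST i. (p ^^ i) c = q)"
    have i: "(p ^^ i) c = q" unfolding i_def using ex by (rule LeastI_ex)
    then obtain j where j: "i = Suc j" using qc by (cases i) auto
    define e where "e = (p ^^ j) c"
    have pe: "p e = q" using i j by (simp add: e_def)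
    have "e \<noteq> q" using not_less_Least[of j "\<lambda>i. (p ^^ i) c = q"] j by (simp add: e_def i_def)
    then have "e \<noteq> r" using pe T by (auto simp: ptree_def)
    moreover have "e \<in> pverts G" using ptree_orbit[OF T] c D by (auto simp: e_def)
    ultimately have "e \<in> ?ch q" using pe by (simp add: children_def)
    moreover have "e \<in> Anc" by (auto simp: Anc_def e_def)
    ultimately have "?ch q - Anc \<subset> ?ch q" by blast
    then have "card (?ch q - Anc) < card (?ch q)"
      using pair_finite_verts by (intro psubset_card_mono) auto
    moreover have "card (B q) \<le> (if ?deg q \<le> k + 1 then card (?ch q - Anc) else 0) + 1"
      unfolding B_def by (rule order_trans[OF card_Un_le]) auto
    ultimately show ?thesis using k by (auto simp: tdeg_def split: if_splits)
  qed
  \<comment> \<open>If \<open>c\<close> is not the root, its parent edge leaves it at most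
    \<open>k - 1\<close> children, which offsets the \<open>k + 1\<close> of the root.\<close>
  have "(\<Sum>q\<in>D. card (B q)) \<le> k * card D"
  proof (cases "c = r")
    case True
    then have "card (B q) \<le> k" for q using Bc Bq[of q] by (cases "q = c") auto
    then show ?thesis using sum_bounded_above[of D "\<lambda>q. card (B q)" k] by (simp add: mult.commute)
  next
    case False
    have "(\<Sum>q\<in>D. card (B q)) = card (B c) + card (B r) + (\<Sum>q\<in>D - {c, r}. card (B q))"
      using fin c rD False
      by (subst sum.subset_diff[of "{c, r}" D]) auto
    moreover have "card (B q) \<le> k" if "q \<in> D - {c, r}" for q using Bq[of q] that by auto
    then have "(\<Sum>q\<in>D - {c, r}. card (B q)) \<le> card (D - {c, r}) * k"
      using sum_bounded_above[of "D - {c, r}" "\<lambda>q. card (B q)" k] by simp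
    moreover have "card (B c) + card (B r) \<le> 2 * k" using Bc Bq[of r] False by auto
    moreover have "card D = card (D - {c, r}) + 2"
      using card_Diff_subset[of "{c, r}" D] card_mono[of D "{c, r}"] fin c rD False by auto
    ultimately show ?thesis by (simp add: algebra_simps)
  qed
  with le show ?thesis by (rule order_trans)
qed

lemma children_reattach:
  assumes "w \<in> A" "w \<noteq> r" "p w \<noteq> c"
  shows "children A r (p(w := c)) q =
    (if q = c then insert w (children A r p c) else children A r p q - {w})"
  using assms by (auto simp: children_def)

text \<open>
  The tree minimizes the total deficiency on \<open>D\<close>. If \<open>c\<close> is deficient and some neighbour \<open>w\<close>
  of \<open>c\<close>, not an ancestor of \<open>c\<close>, has a parent with an edge to spare, then attaching \<open>w\<close> to
  \<open>c\<close> instead decreases it.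
\<close>
lemma ptree_large_degrees:
  assumes T0: "ptree D r p0 (pverts G)" "\<And>x. x \<in> X \<Longrightarrow> tdeg (pverts G) r p0 x \<ge> k + 1"
    and D: "D \<subseteq> pverts G" and k: "k \<ge> 1"
    and large: "\<And>c. c \<in> D - X \<Longrightarrow> card (nbhd G c) > k * card D"
  shows "\<exists>p. ptree D r p (pverts G) \<and> (\<forall>c\<in>D. tdeg (pverts G) r p c \<ge> k + 1)"
proof -
  let ?deg = "tdeg (pverts G) r"
  define P where "P p \<longleftrightarrow> ptree D r p (pverts G) \<and> (\<forall>x\<in>X. ?deg p x \<ge> k + 1)" for p
  \<comment> \<open>Subtraction is truncated: a vertex of tree degree above \<open>k + 1\<close>
    contributes 0 and earns no credit.\<close>
  define \<Phi> where "\<Phi> p = (\<Sum>c\<in>D. k + 1 - ?deg p c)" for p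
  have fin: "finite D" using D pair_finite_verts by (rule finite_subset)
  have "P p0" using T0 by (simp add: P_def)
  then obtain p where p: "P p" and min: "\<And>q. P q \<Longrightarrow> \<Phi> p \<le> \<Phi> q"
    using ex_has_least_nat[of P p0 \<Phi>] by blast
  have T: "ptree D r p (pverts G)" using p by (simp add: P_def)
  have "?deg p c \<ge> k + 1" if c: "c \<in> D" for c
  proof (rule ccontr)
    assume "\<not> ?thesis"
    then have cdef: "?deg p c \<le> k" by simp
    then have "c \<in> D - X" using c p by (force simp: P_def)
    then have "card (nbhd G c) > k * card D" by (rule large)
    moreover have "card (nbhd G c) \<le> k * card D"
    proof (rule card_nbhd_le_of_deficient[OF T D k c cdef], rule ccontr)
      fix w assume w: "w \<in> nbhd G c" and anc: "\<And>i. (p ^^ i) c \<noteq> w"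
        and "\<not> ?deg p (p w) \<le> k + 1"
      \<comment> \<open>With \<open>k + 2\<close> the parent can lose one child and still contribute
        0 to \<open>\<Phi>\<close>.\<close>
      then have rich: "?deg p (p w) \<ge> k + 2" by simp
      have wV: "w \<in> pverts G" using w nbhd_subset by blast
      have pwc: "p w \<noteq> c" using rich cdef by auto
      obtain i where "(p ^^ i) c = r" using ptree_reaches_root[OF T] c D by blast
      then have wr: "w \<noteq> r" using anc by blast
      let ?q = "p(w := c)"
      have q: "ptree D r ?q (pverts G)"
        using ptree_reattach[OF T _ wV w anc] c D by blast
      note ch = children_reattach[of w "pverts G" r p c, OF wV wr pwc]
      have deg: "?deg ?q c = ?deg p c + 1" "?deg ?q (p w) + 1 = ?deg p (p w)"
        "\<And>v. v \<noteq> c \<Longrightarrow> v \<noteq> p w \<Longrightarrow> ?deg ?q v = ?deg p v"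
      proof -
        have "w \<notin> children (pverts G) r p c" using pwc by (simp add: children_def)
        then show "?deg ?q c = ?deg p c + 1"
          unfolding tdeg_def ch using pair_finite_verts by simp
        have "w \<in> children (pverts G) r p (p w)" using wV wr by (simp add: children_def)
        then have "card (children (pverts G) r p (p w) - {w}) + 1 = card (children (pverts G) r p (p w))"
          using pair_finite_verts card_Suc_Diff1[of "children (pverts G) r p (p w)" w] by simp
        then show "?deg ?q (p w) + 1 = ?deg p (p w)"
          unfolding tdeg_def ch using pwc by simp
        fix v assume v: "v \<noteq> c" "v \<noteq> p w"
        then have "w \<notin> children (pverts G) r p v" by (simp add: children_def)
        then show "?deg ?q v = ?deg p v" unfolding tdeg_def ch using v by simp
      qed
      have "?deg ?q x \<ge> k + 1" if "x \<in> X" for x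
      proof -
        have "?deg p x \<ge> k + 1" using that p by (simp add: P_def)
        then show ?thesis using deg rich by (cases "x = c"; cases "x = p w") auto
      qed
      then have "P ?q" using q by (simp add: P_def)
      moreover have "\<Phi> ?q < \<Phi> p"
        unfolding \<Phi>_def
      proof (rule sum_strict_mono_ex1[OF fin])
        show "\<forall>v\<in>D. k + 1 - ?deg ?q v \<le> k + 1 - ?deg p v"
        proof
          fix v
          show "k + 1 - ?deg ?q v \<le> k + 1 - ?deg p v"
            using deg rich by (cases "v = c"; cases "v = p w") auto
        qed
        show "\<exists>v\<in>D. k + 1 - ?deg ?q v < k + 1 - ?deg p v"
          using c cdef deg(1) by (intro bexI[of _ c]) auto
      qed
      ultimately show False using min[of ?q] by simp
    qed
    ultimately show False by simp
  qed
  then show ?thesis using T by blast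
qed

section \<open>From parent functions to spanning trees in the graph sense\<close>

definition tree_graph :: "'a \<Rightarrow> ('a \<Rightarrow> 'a) \<Rightarrow> 'a pair_pre_digraph" where
  "tree_graph r p = \<lparr> pverts = pverts G,
     parcs = {(v, p v) |v. v \<in> pverts G - {r}} \<union> {(p v, v) |v. v \<in> pverts G - {r}} \<rparr>"

lemma tree_graph_simps [simp]:
  "pverts (tree_graph r p) = pverts G"
  "(u, v) \<in> parcs (tree_graph r p) \<longleftrightarrow>
     u \<in> pverts G - {r} \<and> v = p u \<or> v \<in> pverts G - {r} \<and> u = p v"
  by (auto simp: tree_graph_def)

lemma tree_graph_subset:
  assumes "ptree D r p (pverts G)"
  shows "parcs (tree_graph r p) \<subseteq> parcs G"
proof -
  have "(v, p v) \<in> parcs G" if "v \<in> pverts G - {r}" for v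
    using assms that by (auto simp: ptree_def nbhd_iff)
  then show ?thesis by (auto simp: tree_graph_def dest: arcs_symmetric)
qed

lemma pair_graph_tree_graph:
  assumes T: "ptree D r p (pverts G)"
  shows "pair_graph (tree_graph r p)"
proof
  note sub = tree_graph_subset[OF T]
  show "fst e \<in> pverts (tree_graph r p)" "snd e \<in> pverts (tree_graph r p)"
    if "e \<in> parcs (tree_graph r p)" for e
    using that sub arc_fst_in_verts arc_snd_in_verts by auto
  show "finite (pverts (tree_graph r p))" using pair_finite_verts by simp
  show "finite (parcs (tree_graph r p))" using sub pair_finite_arcs by (rule finite_subset)
  show "fst e \<noteq> snd e" if "e \<in> parcs (tree_graph r p)" for e
    using that sub pair_no_loops by auto
  show "symmetric (with_proj (tree_graph r p))"
    by (auto simp: symmetric_def intro!: symI)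
qed

lemma connected_tree_graph:
  assumes T: "ptree D r p (pverts G)"
  shows "Digraph_Component.connected (with_proj (tree_graph r p))"
proof -
  let ?R = "rtrancl_on (pverts G) (parcs (tree_graph r p))"
  have sym: "sym (parcs (tree_graph r p))" by (rule symI) (simp add: disj_commute)
  obtain h :: "'a \<Rightarrow> nat" where h: "\<forall>v\<in>pverts G - {r}. h (p v) < h v"
    using T unfolding ptree_def by blast
  have root: "(v, r) \<in> ?R" if "v \<in> pverts G" for v
    using that
  proof (induct "h v" arbitrary: v rule: less_induct)
    case less
    show ?case
    proof (cases "v = r")
      case False
      then have "h (p v) < h v" using h less.prems by simp
      then have "(p v, r) \<in> ?R"
        using ptree_parent(1)[OF T less.prems False] by (rule less.hyps)
      moreover have "(v, p v) \<in> parcs (tree_graph r p)"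
        using less.prems False by simp
      ultimately show ?thesis
        using converse_rtrancl_on_into_rtrancl_on less.prems by metis
    next
      case True
      then show ?thesis using rtrancl_on_refl[OF less.prems] by simp
    qed
  qed
  have R: "(u, v) \<in> ?R" if "u \<in> pverts G" "v \<in> pverts G" for u v
    by (rule rtrancl_on_trans[OF root[OF that(1)] symD[OF rtrancl_on_sym[OF sym] root[OF that(2)]]])
  have sub: "parcs (tree_graph r p) \<subseteq> (parcs (tree_graph r p))\<^sup>s"
    unfolding symcl_def by (rule Un_upper1)
  have "pverts G \<noteq> {}" using T by (auto simp: ptree_def)
  then show ?thesis
    unfolding connected_conv with_proj_simps tree_graph_simps(1)
    by (intro conjI ballI rtrancl_on_mono[OF sub order_refl R])
qed

lemma pcas_nth:
  assumes "pcas u es v" "es \<noteq> []"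
  shows "fst (es ! 0) = u" "snd (last es) = v"
    and "Suc i < length es \<Longrightarrow> snd (es ! i) = fst (es ! Suc i)"
proof -
  have "es \<noteq> [] \<longrightarrow> fst (es ! 0) = u \<and> snd (last es) = v \<and>
    (\<forall>i. Suc i < length es \<longrightarrow> snd (es ! i) = fst (es ! Suc i))"
    using assms(1)
  proof (induct es arbitrary: u)
    case (Cons e es)
    then show ?case
      by (cases es) (auto simp: nth_Cons split: nat.splits)
  qed simp
  then show "fst (es ! 0) = u" "snd (last es) = v"
    and "Suc i < length es \<Longrightarrow> snd (es ! i) = fst (es ! Suc i)"
    using assms(2) by auto
qed

text \<open>
  On a cycle, both neighbours of a vertex of maximal height would be its parent.
\<close>
lemma tree_graph_no_cycle:
  assumes T: "ptree D r p (pverts G)"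
    and cyc: "pre_digraph.cycle (with_proj (tree_graph r p)) es"
  shows "length es < 3"
proof (rule ccontr)
  define L where "L = length es"
  assume "\<not> length es < 3"
  then have L: "L \<ge> 3" by (simp add: L_def)
  interpret T: pair_graph "tree_graph r p" by (rule pair_graph_tree_graph[OF T])
  obtain h :: "'a \<Rightarrow> nat" where h: "\<forall>v\<in>pverts G - {r}. h (p v) < h v"
    using T unfolding ptree_def by blast
  obtain u where u: "T.awalk u es u" "distinct (tl (pawalk_verts u es))" "es \<noteq> []"
    using cyc unfolding T.cycle_def by blast
  have cas: "pcas u es u" and arcs: "set es \<subseteq> parcs (tree_graph r p)"
    using u(1) by (auto simp: T.awalk_def)
  have verts: "pawalk_verts u es = fst (hd es) # map snd es" if "pcas u es v" "es \<noteq> []" for u v es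
    using that
  proof (induct es arbitrary: u)
    case (Cons e es)
    then show ?case by (cases es) auto
  qed simp
  have dist: "distinct (map snd es)" using u(2) verts[OF cas u(3)] by simp
  \<comment> \<open>Cyclic indexing: \<open>s i\<close> is the head of one arc of the cycle and the
    tail of the next.\<close>
  define s where "s i = snd (es ! (i mod L))" for i
  have step: "fst (es ! (Suc i mod L)) = s i" for i
  proof (cases "Suc (i mod L) = L")
    case True
    then have "Suc i mod L = 0" by (simp add: mod_Suc)
    moreover have "i mod L = length es - 1" using True L_def by simp
    then have "es ! (i mod L) = last es" using u(3) by (simp add: last_conv_nth)
    ultimately show ?thesis using pcas_nth(1,2)[OF cas u(3)] by (simp add: s_def)
  next
    case False
    then have "Suc (i mod L) < L" using L by (simp add: Suc_lessI)
    then show ?thesis using pcas_nth(3)[OF cas u(3), of "i mod L"] False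
      by (simp add: s_def mod_Suc L_def)
  qed
  have modL: "i mod L < length es" for i
    using L mod_less_divisor[of L i] unfolding L_def by linarith
  have arc: "(s i, s (Suc i)) \<in> parcs (tree_graph r p)" for i
  proof -
    have "es ! (Suc i mod L) \<in> parcs (tree_graph r p)" using nth_mem[OF modL] arcs by blast
    moreover have "es ! (Suc i mod L) = (s i, s (Suc i))" using step[of i] by (simp add: s_def prod_eq_iff)
    ultimately show ?thesis by (simp only:)
  qed
  have inj: "i mod L = j mod L" if "s i = s j" for i j
  proof -
    have "i mod L < length (map snd es)" "j mod L < length (map snd es)"
      using modL by (simp_all only: length_map)
    moreover from this have "map snd es ! (i mod L) = map snd es ! (j mod L)"
      using that by (simp only: s_def nth_map length_map)
    ultimately show ?thesis using nth_eq_iff_index_eq[OF dist] by blast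
  qed
  have "finite (range s)"
  proof (rule finite_subset)
    show "range s \<subseteq> snd ` set es" unfolding s_def using nth_mem[OF modL] by blast
  qed simp
  then have fin: "finite (h ` range s)" by (rule finite_imageI)
  then have "Max (h ` range s) \<in> h ` range s" by (intro Max_in) auto
  then obtain i where "h (s i) = Max (h ` range s)" by auto
  then have i: "h (s j) \<le> h (s i)" for j using fin by auto
  have si: "s (i + L) = s i" by (simp add: s_def)
  \<comment> \<open>The predecessor of \<open>i\<close> on the cycle, shifted by \<open>L\<close> so
    that \<open>i = 0\<close> causes no truncation.\<close>
  define j where "j = i + L - 1"
  have j: "s (Suc j) = s i" using si L by (simp add: j_def)
  \<comment> \<open>In a tree arc one end is the parent of the other; if \<open>s i\<close> were the
    parent of \<open>x\<close>, it would be strictly lower than \<open>x\<close>.\<close>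
  have parent: "x = p (s i)" if "(x, s i) \<in> parcs (tree_graph r p)" "h x \<le> h (s i)" for x
    using that h[rule_format, of x] by auto
  have "s j = p (s i)" using parent[OF _ i] arc[of j] unfolding j by blast
  moreover have "(s (Suc (Suc j)), s i) \<in> parcs (tree_graph r p)"
    using T.arcs_symmetric[OF arc[of "Suc j"]] unfolding j .
  then have "s (Suc (Suc j)) = p (s i)" using i by (rule parent)
  ultimately have "j mod L = (j + 2) mod L" using inj[of j "j + 2"] by simp
  then have "L dvd j + 2 - j" using mod_eq_dvd_iff_nat[of j "j + 2" L] by simp
  then have "L \<le> 2" by (intro dvd_imp_le) simp_all
  then show False using L by simp
qed

text \<open>Vertices outside \<open>D\<close> are leaves, since the root and all parents lie in
  \<open>D\<close>; so degrees have to be controlled on \<open>D\<close> only.\<close>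

lemma is_2k_ST_tree_graph:
  assumes T: "ptree D r p (pverts G)" and k: "k \<ge> 1"
    and deg: "\<And>c. c \<in> D \<Longrightarrow> tdeg (pverts G) r p c \<ge> k + 1"
  shows "is_2k_ST k (tree_graph r p) G"
proof -
  interpret T: pair_graph "tree_graph r p" by (rule pair_graph_tree_graph[OF T])
  obtain h :: "'a \<Rightarrow> nat" where h: "\<forall>v\<in>pverts G - {r}. h (p v) < h v"
    using T unfolding ptree_def by blast
  have "degree (tree_graph r p) v \<notin> {2..k}" if v: "v \<in> pverts G" for v
  proof -
    have "nbhd (tree_graph r p) v = children (pverts G) r p v \<union> (if v = r then {} else {p v})"
      using v by (auto simp: nbhd_def children_def)
    moreover have "p v \<notin> children (pverts G) r p v" if "v \<noteq> r"
    proof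
      assume "p v \<in> children (pverts G) r p v"
      then have "p v \<in> pverts G - {r}" "p (p v) = v" by (auto simp: children_def)
      then have "h v < h (p v)" using h[rule_format, of "p v"] by simp
      moreover have "h (p v) < h v" using h v that by blast
      ultimately show False by simp
    qed
    ultimately have d: "degree (tree_graph r p) v = tdeg (pverts G) r p v"
      unfolding T.degree_eq_card_nbhd using pair_finite_verts by (auto simp: tdeg_def)
    show ?thesis
    proof (cases "v \<in> D")
      case True
      then show ?thesis using deg[of v] d by simp
    next
      case False
      then have "children (pverts G) r p v = {}" "v \<noteq> r"
        using T by (auto simp: children_def ptree_def)
      then show ?thesis using d by (simp add: tdeg_def)
    qed
  qed
  moreover have "spanning (with_proj (tree_graph r p)) (with_proj G)"
    using tree_graph_subset[OF T] wf_digraph_axioms T.wf_digraph_axioms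
    by (simp add: spanning_def subgraph_def compatible_def)
  moreover have "is_tree (tree_graph r p)"
    unfolding is_tree_def
  proof (intro conjI notI)
    assume "\<exists>es. pre_digraph.cycle (with_proj (tree_graph r p)) es \<and> 3 \<le> length es"
    then obtain es where "pre_digraph.cycle (with_proj (tree_graph r p)) es" "3 \<le> length es" by blast
    then show False using tree_graph_no_cycle[OF T] by (metis not_le)
  qed (fact T.pair_graph_axioms connected_tree_graph[OF T])+
  ultimately show ?thesis by (simp add: is_2k_ST_def is_spanning_tree_def)
qed

section \<open>Small connected dominating sets\<close>

definition undom :: "'a set \<Rightarrow> 'a set" where
  "undom D = {v \<in> pverts G - D. nbhd G v \<inter> D = {}}"

lemma undom_antimono: "D \<subseteq> D' \<Longrightarrow> undom D' \<subseteq> undom D"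
  by (auto simp: undom_def)

lemma finite_undom [simp]: "finite (undom D)"
  using pair_finite_verts by (simp add: undom_def)

end

text \<open>The derivative \<open>8 / n + 4 / u\<close> of the potential is the reciprocal of the
  rate \<open>g\<close>, and the potential is concave. So a drop of \<open>s * g\<close> in
  \<open>u\<close> lowers it by at least \<open>s\<close>.\<close>

lemma potential_decrease:
  fixes u u' n s :: real
  assumes u: "0 < u" and u': "0 < u'" and n: "0 < n"
    and le: "u' \<le> u - s * (u * n / (8 * u + 4 * n))"
  shows "s + (8 * u' / n + 4 * ln u') \<le> 8 * u / n + 4 * ln u"
proof -
  define g where "g = u * n / (8 * u + 4 * n)"
  have "8 / n + 4 / u = (8 * u + 4 * n) / (u * n)" using u n by (simp add: field_simps)
  moreover have "8 * u + 4 * n > 0" using u n by simp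
  ultimately have g: "g * (8 / n + 4 / u) = 1" using u n by (simp add: g_def)
  have "ln u' - ln u \<le> (u' - u) / u" using u' u by (rule ln_diff_le)
  then have "8 * (u' - u) / n + 4 * (ln u' - ln u) \<le> 8 * (u' - u) / n + 4 * ((u' - u) / u)"
    by (intro add_left_mono mult_left_mono) simp_all
  also have "\<dots> = (u' - u) * (8 / n + 4 / u)" by (simp add: algebra_simps)
  also have "\<dots> \<le> - (s * g) * (8 / n + 4 / u)"
    using le u n by (intro mult_right_mono) (auto simp: g_def)
  also have "\<dots> = - s" using g by simp
  finally show ?thesis by (simp add: diff_divide_distrib algebra_simps)
qed

text \<open>\<open>X\<close> is put into the dominating set at the start and \<open>W\<close>
  supplies all later vertices. Two situations are covered: low connectors with \<open>W\<close> the
  high vertices, and one arbitrary vertex with \<open>W\<close> all vertices when none is low.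
  Counting closed neighbourhoods in \<open>many\<close> recovers the 1 lost in
  \<open>(n - 2) / 2 = n / 2 - 1\<close>.\<close>

locale domination = pair_graph +
  fixes X W :: "'a set" and r :: 'a
  assumes root: "r \<in> X" and X_verts: "X \<subseteq> pverts G" and W_verts: "W \<subseteq> pverts G"
    and X_connected: "\<And>x. x \<in> X \<Longrightarrow> (r, x) \<in> rtrancl_on X (parcs G)"
    and W_reachable: "\<And>w. w \<in> W \<Longrightarrow> (r, w) \<in> rtrancl_on (W \<union> X) (parcs G)"
    and undom_X: "undom X \<subseteq> W"
    and many: "\<And>z. z \<in> undom X \<Longrightarrow> card (pverts G) \<le> 4 * card (insert z (nbhd G z) \<inter> W)"
begin

definition core :: "'a set \<Rightarrow> bool" where
  "core D \<longleftrightarrow> X \<subseteq> D \<and> D \<subseteq> W \<union> X \<and> (\<forall>d\<in>D. (r, d) \<in> rtrancl_on D (parcs G))"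

lemma core_X: "core X"
  using X_connected by (simp add: core_def)

lemma core_finite: "core D \<Longrightarrow> finite D"
  using X_verts W_verts pair_finite_verts finite_subset[of D "pverts G"] by (auto simp: core_def)

lemma core_insert:
  assumes D: "core D" and y: "y \<in> W" "d \<in> D" "d \<in> nbhd G y"
  shows "core (insert y D)"
proof -
  have mono: "(r, v) \<in> rtrancl_on (insert y D) (parcs G)" if "v \<in> D" for v
  proof -
    have "(r, v) \<in> rtrancl_on D (parcs G)" using D that by (simp add: core_def)
    then show ?thesis by (rule rtrancl_on_mono[OF order_refl subset_insertI])
  qed
  moreover have "(d, y) \<in> parcs G" using y(3) by (simp add: nbhd_iff arcs_symmetric)
  then have "(r, y) \<in> rtrancl_on (insert y D) (parcs G)"
    using rtrancl_on_into_rtrancl_on[OF mono[OF y(2)]] by simp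
  ultimately show ?thesis using D y(1) by (auto simp: core_def)
qed

lemma core_undom:
  assumes "core D"
  shows "undom D \<subseteq> undom X" "undom D \<subseteq> W" "undom D \<inter> D = {}"
proof -
  show "undom D \<subseteq> undom X" using assms by (intro undom_antimono) (simp add: core_def)
  with undom_X show "undom D \<subseteq> W" by blast
qed (auto simp: undom_def)

text \<open>On a path from \<open>r\<close> to an undominated vertex, the last vertex before the
  path enters \<open>undom D\<close> is dominated but not in \<open>D\<close>. Adding it keeps
  \<open>D\<close> connected and dominates its successor.\<close>

lemma core_step1:
  assumes D: "core D" and U: "undom D \<noteq> {}"
  shows "\<exists>D'. core D' \<and> card D' \<le> card D + 1 \<and> card (undom D') < card (undom D)"
proof -
  obtain z where z: "z \<in> undom D" using U by blast
  then have zW: "z \<in> W" using core_undom[OF D] by blast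
  have rP: "r \<in> - undom D" and zP: "z \<notin> - undom D"
    using root D z by (auto simp: core_def undom_def)
  obtain y v where yv: "(y, v) \<in> parcs G" "y \<in> (W \<union> X) \<inter> - undom D" "v \<in> (W \<union> X) - - undom D"
    by (rule rtrancl_on_crossing[OF W_reachable[OF zW] rP zP])
  have v: "v \<in> undom D" "y \<in> nbhd G v" using yv by (auto simp: nbhd_iff arcs_symmetric)
  then have "y \<notin> D" by (auto simp: undom_def)
  moreover from this have "y \<in> W" using yv(2) D by (auto simp: core_def)
  moreover from calculation obtain d where "d \<in> D" "d \<in> nbhd G y"
    using yv(2) W_verts by (auto simp: undom_def)
  ultimately have "core (insert y D)" using core_insert[OF D] by blast
  moreover have "undom (insert y D) \<subset> undom D"
    using v undom_antimono[of D "insert y D"] by (auto simp: undom_def)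
  then have "card (undom (insert y D)) < card (undom D)" by (intro psubset_card_mono) auto
  moreover have "card (insert y D) \<le> card D + 1" by (simp add: card_insert_if core_finite[OF D])
  ultimately show ?thesis by blast
qed

text \<open>
  Either one vertex dominates many undominated vertices, or some undominated \<open>z\<close> has few
  dominated neighbours, so that \<open>z\<close> itself, joined to \<open>D\<close> by one vertex, dominates many; a vertex
  \<open>z\<close> too far from \<open>D\<close> for this dominates its whole neighbourhood, and two vertices join it to
  \<open>D\<close>. The gain is measured so that \<open>s\<close> added vertices pay for \<open>s\<close> units of
  \<open>8 u / n + 4 ln u\<close>.
\<close>
lemma core_step:
  assumes D: "core D" and U: "undom D \<noteq> {}"
  defines "n \<equiv> real (card (pverts G))" and "u \<equiv> real (card (undom D))"
  shows "\<exists>D' s. core D' \<and> s \<in> {1, 2, 3} \<and> card D' \<le> card D + s \<and>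
    real (card (undom D')) \<le> u - real s * (u * n / (8 * u + 4 * n))"
proof -
  let ?U = "undom D"
  define N where "N z = insert z (nbhd G z) \<inter> W" for z
  define F where "F = W - ?U"
  have finD: "finite D" by (rule core_finite[OF D])
  have finW: "finite W" using W_verts pair_finite_verts by (rule finite_subset)
  have finF: "finite F" using finW by (simp add: F_def)
  have UW: "?U \<subseteq> W" using core_undom[OF D] by blast
  have UV: "?U \<subseteq> pverts G" by (auto simp: undom_def)
  have u0: "u > 0" using U by (simp add: u_def card_gt_0_iff)
  have un: "u \<le> n" unfolding u_def n_def using card_mono[OF pair_finite_verts UV] by simp
  have n0: "n > 0" using u0 un by simp
  have many': "n / 4 \<le> real (card (N z))" if "z \<in> ?U" for z
    using many[of z] core_undom[OF D] that unfolding N_def n_def by (auto simp: field_simps simp flip: of_nat_mult)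
  have finN: "finite (N z)" for z using finW by (simp add: N_def)
  have Fdom: "\<exists>d\<in>D. d \<in> nbhd G y" if "y \<in> F" "y \<notin> D" for y
    using that W_verts by (auto simp: F_def undom_def)
  have gain: "real (card (undom D')) \<le> u - real (card S)" if "D \<subseteq> D'" "S \<subseteq> ?U" "S \<inter> undom D' = {}" for D' S
  proof -
    have "undom D' \<subseteq> ?U - S" using that undom_antimono[OF that(1)] by blast
    then have "card (undom D') \<le> card (?U - S)" by (intro card_mono) auto
    also have "\<dots> = card ?U - card S" using that(2) finite_undom by (intro card_Diff_subset) (auto intro: finite_subset)
    finally have "card (undom D') + card S \<le> card ?U"
      using card_mono[OF finite_undom that(2)] by linarith
    then show ?thesis by (simp add: u_def flip: of_nat_add)
  qed
  have close: "z \<in> D' \<Longrightarrow> N z \<inter> undom D' = {}" for z D'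
    using nbhd_commute by (auto simp: N_def undom_def)
  consider (far) z where "z \<in> ?U" "N z \<inter> F = {}"
    | (big) y where "y \<in> F" "real (card (nbhd G y \<inter> ?U)) \<ge> u * n / (8 * u + 4 * n)"
    | (rest) "\<forall>z\<in>?U. N z \<inter> F \<noteq> {}" "\<forall>y\<in>F. real (card (nbhd G y \<inter> ?U)) < u * n / (8 * u + 4 * n)"
    by (meson not_le)
  then show ?thesis
  proof cases
    case far
    \<comment> \<open>A path from \<open>r\<close> to \<open>z\<close> must step from some
      \<open>v'\<close> in \<open>P\<close> to a far vertex \<open>v\<close>. As \<open>v\<close>
      has no dominated neighbour in \<open>W\<close>, \<open>v'\<close> is undominated, but it has
      such a neighbour \<open>y\<close>; thus \<open>y\<close> and \<open>v'\<close> join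
      \<open>v\<close> to \<open>D\<close>.\<close>
    define P where "P = {v. v \<notin> ?U \<or> N v \<inter> F \<noteq> {}}"
    have P: "r \<in> P" "z \<notin> P" using root D far by (auto simp: P_def core_def undom_def)
    have zW: "z \<in> W" using far UW by blast
    obtain v' v where v: "(v', v) \<in> parcs G" "v' \<in> (W \<union> X) \<inter> P" "v \<in> (W \<union> X) - P"
      by (rule rtrancl_on_crossing[OF W_reachable[OF zW] P])
    then have vU: "v \<in> ?U" and vF: "N v \<inter> F = {}" by (auto simp: P_def)
    have adj: "v' \<in> nbhd G v" "v \<in> nbhd G v'" using v(1) by (auto simp: nbhd_iff arcs_symmetric)
    have "v' \<notin> D" using adj vU by (auto simp: undom_def)
    then have v'W: "v' \<in> W" using v(2) D by (auto simp: core_def)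
    then have v'U: "v' \<in> ?U" using vF adj by (auto simp: N_def F_def)
    then obtain y where y: "y \<in> N v' \<inter> F" using v(2) by (auto simp: P_def)
    then have yv: "y \<in> nbhd G v'" "y \<in> F" "y \<in> W" using v'U by (auto simp: N_def F_def)
    then have "y \<notin> D" using v'U by (auto simp: undom_def)
    then obtain d where d: "d \<in> D" "d \<in> nbhd G y" using Fdom yv by blast
    have "core (insert y D)" using core_insert[OF D yv(3) d] .
    then have "core (insert v' (insert y D))" using core_insert[of _ v' y] v'W yv by blast
    then have c: "core (insert v (insert v' (insert y D)))"
      using core_insert[of _ v v'] vU UW adj by blast
    have "N v \<subseteq> ?U" using vF by (auto simp: F_def N_def)
    then have "real (card (undom (insert v (insert v' (insert y D))))) \<le> u - real (card (N v))"
      by (intro gain close) auto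
    also have "\<dots> \<le> u - n / 4" using many'[OF vU] by simp
    \<comment> \<open>Equivalent to \<open>u <= n\<close>.\<close>
    also have "\<dots> \<le> u - real 3 * (u * n / (8 * u + 4 * n))"
      using u0 n0 un by (simp add: field_simps)
    finally have "real (card (undom (insert v (insert v' (insert y D))))) \<le> u - real 3 * (u * n / (8 * u + 4 * n))" .
    moreover have "card (insert v (insert v' (insert y D))) \<le> card D + 3"
      using finD by (simp add: card_insert_if)
    ultimately show ?thesis using c by blast
  next
    case big
    have "u * n / (8 * u + 4 * n) > 0" using u0 n0 by simp
    then have "nbhd G y \<inter> ?U \<noteq> {}" using big(2) by auto
    then have "y \<notin> D" using nbhd_commute by (auto simp: undom_def)
    then obtain d where d: "d \<in> D" "d \<in> nbhd G y" using Fdom big by blast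
    have c: "core (insert y D)" using core_insert[OF D _ d] big(1) by (auto simp: F_def)
    have "real (card (undom (insert y D))) \<le> u - real (card (nbhd G y \<inter> ?U))"
      using nbhd_commute by (intro gain) (auto simp: undom_def)
    also have "\<dots> \<le> u - real 1 * (u * n / (8 * u + 4 * n))" using big(2) by simp
    finally have "real (card (undom (insert y D))) \<le> u - real 1 * (u * n / (8 * u + 4 * n))" .
    moreover have "card (insert y D) \<le> card D + 1" using finD by (simp add: card_insert_if)
    ultimately show ?thesis using c by blast
  next
    case rest
    let ?g = "u * n / (8 * u + 4 * n)"
    \<comment> \<open>Double counting of the edges between \<open>?U\<close> and \<open>F\<close>:
      every vertex of \<open>F\<close> sees fewer than \<open>?g\<close> vertices of
      \<open>?U\<close>, so the average number of neighbours in \<open>F\<close> is at most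
      \<open>n * ?g / u\<close>.\<close>
    have "\<exists>z\<in>?U. real (card (nbhd G z \<inter> F)) \<le> n * n / (8 * u + 4 * n)"
    proof (rule ccontr)
      assume "\<not> ?thesis"
      then have less: "n * n / (8 * u + 4 * n) < real (card (nbhd G z \<inter> F))" if "z \<in> ?U" for z
        using that by force
      have "u * (n * n / (8 * u + 4 * n)) = (\<Sum>z\<in>?U. n * n / (8 * u + 4 * n))" by (simp add: u_def)
      also have "\<dots> < (\<Sum>z\<in>?U. real (card (nbhd G z \<inter> F)))"
        using less U by (intro sum_strict_mono) auto
      also have "\<dots> = real (\<Sum>z\<in>?U. card {y \<in> F. y \<in> nbhd G z})"
        by (simp add: Int_def conj_commute)
      also have "(\<Sum>z\<in>?U. card {y \<in> F. y \<in> nbhd G z}) = (\<Sum>y\<in>F. card {z \<in> ?U. y \<in> nbhd G z})"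
        using finF by (intro sum_multicount_gen) auto
      also have "real \<dots> = (\<Sum>y\<in>F. real (card (nbhd G y \<inter> ?U)))"
        using nbhd_commute by (simp add: Int_def conj_commute)
      also have "\<dots> \<le> (\<Sum>y\<in>F. ?g)" using rest(2) by (intro sum_mono) auto
      also have "\<dots> = real (card F) * ?g" by simp
      also have "\<dots> \<le> n * ?g"
        using card_mono[OF pair_finite_verts, of F] W_verts u0 n0
        by (intro mult_right_mono) (auto simp: n_def F_def)
      finally show False by (simp add: mult_ac)
    qed
    then obtain z where z: "z \<in> ?U" "real (card (nbhd G z \<inter> F)) \<le> n * n / (8 * u + 4 * n)" by blast
    obtain y where y: "y \<in> N z" "y \<in> F" using rest(1) z(1) by blast
    then have yz: "y \<in> nbhd G z" "y \<in> W" using z(1) by (auto simp: N_def F_def)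
    then have "y \<notin> D" using z(1) by (auto simp: undom_def)
    then obtain d where d: "d \<in> D" "d \<in> nbhd G y" using Fdom y by blast
    have "core (insert y D)" using core_insert[OF D yz(2) d] .
    then have c: "core (insert z (insert y D))"
      using core_insert[of _ z y] z(1) UW yz(1) by blast
    have "N z - F \<subseteq> ?U" by (auto simp: F_def N_def)
    moreover have "(N z - F) \<inter> undom (insert z (insert y D)) = {}" using close[of z] by blast
    ultimately have le: "real (card (undom (insert z (insert y D)))) \<le> u - real (card (N z - F))"
      by (intro gain) auto
    have "N z \<inter> F = nbhd G z \<inter> F" using z(1) by (auto simp: N_def F_def)
    then have "card (N z) = card (N z - F) + card (nbhd G z \<inter> F)"
      using card_Int_Diff[OF finN, of z F] by simp
    then have "real (card (N z - F)) \<ge> n / 4 - n * n / (8 * u + 4 * n)"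
      using many'[OF z(1)] z(2) by simp
    \<comment> \<open>The rate \<open>?g\<close> is the solution of
      \<open>n / 4 - n * g / u = 2 * g\<close>, which balances one vertex of \<open>F\<close>
      against the pair \<open>y\<close>, \<open>z\<close>.\<close>
    moreover have "n / 4 - n * n / (8 * u + 4 * n) = real 2 * ?g"
      using u0 n0 by (simp add: field_simps)
    ultimately have "real (card (undom (insert z (insert y D)))) \<le> u - real 2 * ?g" using le by linarith
    moreover have "card (insert z (insert y D)) \<le> card D + 2" using finD by (simp add: card_insert_if)
    ultimately show ?thesis using c by blast
  qed
qed

lemma connected_dominating_set:
  assumes D: "core D" and U: "undom D \<noteq> {}"
  shows "\<exists>D'. core D' \<and> undom D' = {} \<and>
    real (card D') \<le> real (card D) + 8 * real (card (undom D)) / real (card (pverts G)) +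
      4 * ln (real (card (undom D))) + 1"
  using assms
proof (induct "card (undom D)" arbitrary: D rule: less_induct)
  case less
  let ?n = "real (card (pverts G))" and ?u = "real (card (undom D))"
  have u0: "card (undom D) > 0" using less.prems by (simp add: card_gt_0_iff)
  have "card (undom D) \<le> card (pverts G)" using pair_finite_verts by (intro card_mono) (auto simp: undom_def)
  with u0 have n0: "?n > 0" by simp
  show ?case
  proof (cases "card (undom D) = 1")
    \<comment> \<open>Here \<open>ln 1 = 0\<close>, and the summand 1 of the bound pays for the
      single vertex from \<open>core_step1\<close>.\<close>
    case True
    obtain D' where D': "core D'" "card D' \<le> card D + 1" "card (undom D') < card (undom D)"
      using core_step1[OF less.prems] by (elim exE conjE) (rule that)
    have "undom D' = {}" using D'(3) True by simp
    moreover have "real (card D') \<le> real (card D) + 1" "8 * ?u / ?n \<ge> 0" "ln ?u = 0"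
      using D'(2) True by simp_all
    then have "real (card D') \<le> real (card D) + 8 * ?u / ?n + 4 * ln ?u + 1" by linarith
    ultimately show ?thesis using D'(1) by (intro exI[of _ D'] conjI)
  next
    case False
    then have u2: "?u \<ge> 2" using u0 by simp
    obtain D' s where D': "core D'" "s \<in> {1, 2, 3}" "card D' \<le> card D + s"
      and le: "real (card (undom D')) \<le> ?u - real s * (?u * ?n / (8 * ?u + 4 * ?n))"
      using core_step[OF less.prems] by (elim exE conjE) (rule that)
    show ?thesis
    proof (cases "undom D' = {}")
      case True
      \<comment> \<open>The potential comparison requires a positive number of undominated vertices
        afterwards. Here at most 3 vertices were added, and \<open>4 * ln 2 + 1 >= 3\<close> covers
        them.\<close>
      have "ln (2::real) \<ge> 1 / 2" using ln_diff_le[of 1 "2::real"] by simp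
      moreover have "ln ?u \<ge> ln 2" using u2 by simp
      moreover have "8 * ?u / ?n \<ge> 0" by simp
      moreover have "card D' \<le> card D + 3" using D'(2,3) by auto
      then have "real (card D') \<le> real (card D) + 3" by linarith
      ultimately have "real (card D') \<le> real (card D) + 8 * ?u / ?n + 4 * ln ?u + 1" by linarith
      then show ?thesis using True D'(1) by (intro exI[of _ D'] conjI)
    next
      case False
      let ?u' = "real (card (undom D'))"
      have u'0: "?u' > 0" using False by (simp add: card_gt_0_iff)
      have "?u * ?n / (8 * ?u + 4 * ?n) > 0" using u2 n0 by (intro divide_pos_pos) auto
      then have "real s * (?u * ?n / (8 * ?u + 4 * ?n)) > 0" using D'(2) by (intro mult_pos_pos) auto
      then have "card (undom D') < card (undom D)" using le by linarith
      from less.hyps[OF this D'(1) False] obtain E where E: "core E" "undom E = {}"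
        "real (card E) \<le> real (card D') + 8 * ?u' / ?n + 4 * ln ?u' + 1"
        by (elim exE conjE) (rule that)
      have "real s + (8 * ?u' / ?n + 4 * ln ?u') \<le> 8 * ?u / ?n + 4 * ln ?u"
        using u2 u'0 n0 le by (intro potential_decrease) simp_all
      moreover have "real (card D') \<le> real (card D) + real s" using D'(3) by linarith
      ultimately have "real (card E) \<le> real (card D) + 8 * ?u / ?n + 4 * ln ?u + 1"
        using E(3) by linarith
      then show ?thesis using E(1,2) by (intro exI[of _ E] conjI)
    qed
  qed
qed

text \<open>\<open>Y\<close> collects the connectors whose degrees may be too small for the
  exchange. The starting tree on \<open>A\<close> already gives them \<open>k + 1\<close> tree
  neighbours, and \<open>Y\<close> is then the protected set in
  \<open>ptree_large_degrees\<close>.\<close>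

lemma exists_2k_ST:
  assumes k: "k \<ge> 2" and X: "card X \<le> 2"
    and T: "ptree X r p A" and Y: "Y \<subseteq> X" "\<And>x. x \<in> Y \<Longrightarrow> tdeg A r p x \<ge> k + 1"
    and large: "\<And>c. c \<in> W \<union> X - Y \<Longrightarrow> (real (card (pverts G)) - 2) / 4 \<le> real (card (nbhd G c))"
    and num: "real k * (11 + 4 * ln (card (pverts G))) < (real (card (pverts G)) - 2) / 4"
  shows "\<exists>T. is_2k_ST k T G"
proof -
  let ?n = "real (card (pverts G))"
  have "card (pverts G) > 0" using root X_verts pair_finite_verts by (auto simp: card_gt_0_iff)
  then have n1: "?n \<ge> 1" by simp
  have "\<exists>D. core D \<and> undom D = {} \<and> real (card D) \<le> 11 + 4 * ln ?n"
  proof (cases "undom X = {}")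
    case True
    have "ln ?n \<ge> 0" using n1 by simp
    then have "real (card X) \<le> 11 + 4 * ln ?n" using X by linarith
    then show ?thesis using core_X True by blast
  next
    case False
    let ?u = "real (card (undom X))"
    obtain D where D: "core D" "undom D = {}"
      "real (card D) \<le> real (card X) + 8 * ?u / ?n + 4 * ln ?u + 1"
      using connected_dominating_set[OF core_X False] by blast
    have "card (undom X) \<le> card (pverts G)"
      using pair_finite_verts by (intro card_mono) (auto simp: undom_def)
    moreover have "card (undom X) > 0" using False by (simp add: card_gt_0_iff)
    ultimately have u: "0 < ?u" "?u \<le> ?n" by simp_all
    \<comment> \<open>The constant 11 is \<open>2 + 8 + 1\<close>, from \<open>card X\<close>, the
      linear term of the potential, and the closing vertex.\<close>
    then have "ln ?u \<le> ln ?n" "8 * ?u / ?n \<le> 8" by (simp_all add: divide_le_eq)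
    then have "real (card D) \<le> 11 + 4 * ln ?n" using D(3) X by linarith
    then show ?thesis using D(1,2) by blast
  qed
  then obtain D where D: "core D" "undom D = {}" "real (card D) \<le> 11 + 4 * ln ?n" by blast
  have sub: "X \<subseteq> D" "D \<subseteq> W \<union> X" using D(1) by (simp_all add: core_def)
  then have DV: "D \<subseteq> pverts G" using X_verts W_verts by blast
  obtain h :: "'a \<Rightarrow> nat" where "\<forall>v\<in>A - {r}. h (p v) < h v"
    using T unfolding ptree_def by blast
  then have TD: "ptree D r p A"
    using T sub(1) by (intro ptreeI[where h = h]) (auto simp: ptree_def)
  have "(r, d) \<in> rtrancl_on D (parcs G)" if "d \<in> D" for d
    using D(1) that by (simp add: core_def)
  moreover have "nbhd G v \<inter> D \<noteq> {}" if "v \<in> pverts G - D" for v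
    using D(2) that by (auto simp: undom_def)
  ultimately have "\<exists>q. ptree D r q (pverts G) \<and> (\<forall>v\<in>A. q v = p v)"
    by (rule ptree_extend[OF TD DV])
  then obtain q where q: "ptree D r q (pverts G)" "\<forall>v\<in>A. q v = p v" by blast
  have AV: "A \<subseteq> pverts G" using T by (simp add: ptree_def)
  have degY: "tdeg (pverts G) r q x \<ge> k + 1" if "x \<in> Y" for x
  proof -
    have "children A r p x \<subseteq> children (pverts G) r q x"
      using q(2) AV by (auto simp: children_def)
    then have "card (children A r p x) \<le> card (children (pverts G) r q x)"
      using pair_finite_verts by (intro card_mono) auto
    then show ?thesis using Y(2)[OF that] by (simp add: tdeg_def split: if_splits)
  qed
  have deg: "card (nbhd G c) > k * card D" if "c \<in> D - Y" for c
  proof -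
    have "real k * real (card D) \<le> real k * (11 + 4 * ln ?n)"
      using D(3) by (intro mult_left_mono) auto
    also have "\<dots> < (?n - 2) / 4" by (rule num)
    also have "\<dots> \<le> real (card (nbhd G c))" using that sub by (intro large) auto
    finally show ?thesis by (simp flip: of_nat_mult)
  qed
  have k1: "k \<ge> 1" using k by simp
  obtain q' where q': "ptree D r q' (pverts G)" "\<forall>c\<in>D. tdeg (pverts G) r q' c \<ge> k + 1"
    using ptree_large_degrees[OF q(1) degY DV k1 deg] by blast
  have "is_2k_ST k (tree_graph r q') G"
    by (rule is_2k_ST_tree_graph[OF q'(1) k1]) (use q'(2) in blast)
  then show ?thesis by blast
qed

end

section \<open>The bound on the order\<close>

text \<open>\<open>276 = 69 * 2^2\<close> is the value of \<open>M\<close> in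
  \<open>log_bound_of_n1\<close> at \<open>k = 2\<close>. The exponent 184 is chosen so that
  \<open>184 / 32 = 23 / 4\<close>.\<close>

lemma ln_276: "ln (276::real) \<le> 23 / 4"
proof -
  have "(276::real) \<le> (33 / 32) ^ 184" by (simp add: power_divide)
  also have "\<dots> \<le> exp (1 / 32) ^ 184"
    using exp_ge_add_one_self[of "1 / 32 :: real"] by (intro power_mono) simp_all
  also have "\<dots> = exp (23 / 4 :: real)" by (simp flip: exp_of_nat_mult)
  finally have "ln (276::real) \<le> ln (exp (23 / 4))" by (subst ln_le_cancel_iff) simp_all
  then show ?thesis by simp
qed

text \<open>The factor 69 is dictated by \<open>k = 2\<close>, where \<open>c_const 2 = 4\<close>
  and the condition forces \<open>n >= 276\<close>. For \<open>k >= 3\<close> the cruder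
  \<open>16 * c^2 <= n\<close> already gives \<open>96 * k^2\<close>.\<close>

lemma n1_bound:
  fixes k n :: nat
  assumes k: "k \<ge> 2" and n: "n \<ge> n1 k"
  shows "69 * (real k)\<^sup>2 \<le> real n"
proof -
  define K c s where "K = real k" and "c = c_const k" and "s = sqrt (real n)"
  have K: "K \<ge> 2" using k by (simp add: K_def)
  have "n1 k > 0 \<and> (\<forall>n\<ge>n1 k. real n - 4 * c_const k * sqrt (real n) - 12 * real k + 14 \<ge> 0)"
    unfolding n1_def by (rule LeastI_ex) (rule n1_ex)
  with n have pos: "n > 0" and ge: "real n - 4 * c * s - 12 * K + 14 \<ge> 0"
    by (auto simp: c_def s_def K_def)
  have s0: "s > 0" and s2: "real n = s * s" using pos by (simp_all add: s_def)
  have c0: "c \<ge> 0" using K unfolding c_def c_const_def K_def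
    by (intro mult_nonneg_nonneg add_nonneg_nonneg) auto
  have "sqrt K * sqrt 2 \<ge> sqrt 2 * sqrt 2" using K by (intro mult_right_mono) auto
  then have "(sqrt K + sqrt 2)\<^sup>2 \<ge> K + 6" using K by (simp add: power2_sum)
  then have "(K + 6) * (K * (K - 1)) \<le> (sqrt K + sqrt 2)\<^sup>2 * (K * (K - 1))"
    using K by (intro mult_right_mono) auto
  also have "\<dots> = c\<^sup>2" using K by (simp add: c_def c_const_def power_mult_distrib K_def)
  finally have c2: "(K + 6) * (K * (K - 1)) \<le> c\<^sup>2" .
  have "s * (4 * c) \<le> s * s" using ge s2 K by (simp add: mult_ac)
  then have cs: "4 * c \<le> s" using s0 by simp
  show ?thesis
  proof (cases "k = 2")
    case True
    then have "4\<^sup>2 \<le> c\<^sup>2" using c2 by (simp add: K_def)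
    then have "4 \<le> c" using c0 by (rule power2_le_imp_le)
    then have "4 * s \<le> c * s" using s0 by (intro mult_right_mono) auto
    then have "16 * s + 10 \<le> s * s" using ge s2 True by (simp add: K_def)
    then have 10: "10 \<le> s * (s - 16)" by (simp add: algebra_simps)
    have s16: "16 \<le> s"
    proof (rule ccontr)
      assume "\<not> 16 \<le> s"
      then have "s * (s - 16) \<le> 0" using s0 by (intro mult_nonneg_nonpos) auto
      with 10 show False by simp
    qed
    \<comment> \<open>The positive root of \<open>s^2 - 16 * s - 10\<close> is about 16.602; 16.6
      suffices because \<open>16 * 16.6 + 10 > 275\<close> and \<open>n\<close> is an
      integer.\<close>
    have "16.6 \<le> s"
    proof (rule ccontr)
      assume "\<not> 16.6 \<le> s"
      then have "s * (s - 16) \<le> 16.6 * 0.6" using s0 s16 by (intro mult_mono) auto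
      with 10 show False by simp
    qed
    then have "275 < real n" using 10 s2 by (simp add: algebra_simps)
    then show ?thesis using True by simp
  next
    case False
    then have "K \<ge> 3" using k by (simp add: K_def)
    \<comment> \<open>This product is \<open>(K + 6) * (K * (K - 1)) - 6 * K^2\<close>.\<close>
    then have "(K - 3) * (K + 2) * K \<ge> 0" by simp
    then have "6 * K\<^sup>2 \<le> (K + 6) * (K * (K - 1))" by (simp add: algebra_simps power2_eq_square)
    then have "6 * K\<^sup>2 \<le> c\<^sup>2" using c2 by simp
    moreover have "(4 * c)\<^sup>2 \<le> s\<^sup>2" using cs c0 by (intro power_mono) auto
    ultimately show ?thesis using s2 unfolding K_def by (simp add: power2_eq_square)
  qed
qed

text \<open>By concavity \<open>ln N\<close> lies below the tangent at \<open>M\<close>, and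
  \<open>ln K\<close> below the tangent at 2. What remains is \<open>104 * K + 2 < 53 * K^2\<close>
  with \<open>53 = 69 - 16\<close>; at \<open>K = 2\<close> it reads \<open>210 < 212\<close>, so 69
  and 23/4 leave little room.\<close>

lemma log_bound_of_n1:
  fixes k n :: nat
  assumes k: "k \<ge> 2" and n: "n \<ge> n1 k"
  shows "real k * (11 + 4 * ln n) < (real n - 2) / 4"
proof -
  define K N M where "K = real k" and "N = real n" and "M = 69 * K\<^sup>2"
  have K: "K \<ge> 2" using k by (simp add: K_def)
  then have "2 * K \<le> K\<^sup>2" by (simp add: power2_eq_square)
  then have M: "16 * K \<le> M" "M > 0" using K unfolding M_def by linarith+
  have NM: "M \<le> N" using n1_bound[OF assms] by (simp add: M_def K_def N_def)
  have "ln N - ln M \<le> (N - M) / M" using NM M by (intro ln_diff_le) auto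
  moreover have "ln M = ln 276 + 2 * (ln K - ln 2)"
  proof -
    have "M = 276 * (K / 2)\<^sup>2" by (simp add: M_def power_divide)
    then show ?thesis using K by (simp add: ln_mult ln_realpow ln_div)
  qed
  moreover have "ln K - ln 2 \<le> (K - 2) / 2" using K by (intro ln_diff_le) auto
  ultimately have "ln N \<le> 15 / 4 + K + (N - M) / M" using ln_276 by (simp add: diff_divide_distrib)
  then have "16 * K * ln N \<le> 16 * K * (15 / 4 + K + (N - M) / M)"
    using K by (intro mult_left_mono) auto
  also have "\<dots> = 60 * K + 16 * K\<^sup>2 + 16 * K / M * (N - M)"
    by (simp add: algebra_simps power2_eq_square)
  also have "16 * K / M * (N - M) \<le> 1 * (N - M)"
    using M NM by (intro mult_right_mono) (auto simp: divide_le_eq)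
  finally have "16 * K * ln N \<le> 60 * K + 16 * K\<^sup>2 + (N - M)" by simp
  moreover have "104 * K + 2 < 53 * K\<^sup>2" using \<open>2 * K \<le> K\<^sup>2\<close> K by linarith
  ultimately have "16 * K * ln N + 44 * K + 2 < N" unfolding M_def by linarith
  then show ?thesis by (simp add: K_def N_def algebra_simps)
qed

section \<open>Graphs with large neighbourhood unions\<close>

locale large_unions = pair_graph +
  fixes k n :: nat
  assumes n: "n = card (pverts G)" and k: "k \<ge> 2"
    and connected: "\<And>u v. u \<in> pverts G \<Longrightarrow> v \<in> pverts G \<Longrightarrow> (u, v) \<in> rtrancl_on (pverts G) (parcs G)"
    and min_deg: "\<And>v. v \<in> pverts G \<Longrightarrow> 2 * k \<le> card (nbhd G v)"
    and unions: "\<And>u v. u \<in> pverts G \<Longrightarrow> v \<in> pverts G \<Longrightarrow> u \<noteq> v \<Longrightarrow> v \<notin> nbhd G u \<Longrightarrow>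
      n \<le> 2 * card (nbhd G u \<union> nbhd G v) + 2"
    and num: "real k * (11 + 4 * ln n) < (real n - 2) / 4"
begin

definition Low :: "'a set" where
  "Low = {v \<in> pverts G. 4 * card (nbhd G v) + 2 < n}"

definition High :: "'a set" where
  "High = pverts G - Low"

lemma Low_verts: "Low \<subseteq> pverts G"
  and High_verts: "High \<subseteq> pverts G"
  by (auto simp: Low_def High_def)

lemma finite_Low [simp]: "finite Low"
  and finite_High [simp]: "finite High"
  using Low_verts High_verts pair_finite_verts finite_subset by blast+

lemma High_degree: "v \<in> High \<Longrightarrow> (real n - 2) / 4 \<le> real (card (nbhd G v))"
  by (auto simp: High_def Low_def)

lemma Low_adjacent:
  assumes "x \<in> Low" "y \<in> Low" "x \<noteq> y"
  shows "y \<in> nbhd G x"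
proof (rule ccontr)
  assume "y \<notin> nbhd G x"
  then have "n \<le> 2 * card (nbhd G x \<union> nbhd G y) + 2" using assms Low_verts by (intro unions) auto
  then show False using card_Un_le[of "nbhd G x" "nbhd G y"] assms by (simp add: Low_def)
qed

text \<open>A low neighbour of \<open>u\<close> is not \<open>x\<close>, so it is adjacent to
  \<open>x\<close>; the remaining neighbours are high. Inserting \<open>u\<close> itself absorbs the
  summand 2 of \<open>unions\<close>.\<close>

lemma High_far:
  assumes x: "x \<in> Low" and u: "u \<in> High" "u \<notin> nbhd G x"
  shows "nbhd G u - nbhd G x \<subseteq> High"
    and "n \<le> 2 * card (insert u (nbhd G u - nbhd G x)) + 2 * card (nbhd G x)"
proof -
  have "x \<notin> nbhd G u" using u(2) nbhd_commute by blast
  then show "nbhd G u - nbhd G x \<subseteq> High"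
    using Low_adjacent[OF x] nbhd_subset by (auto simp: High_def)
  have "n \<le> 2 * card (nbhd G x \<union> nbhd G u) + 2"
    using assms Low_verts by (intro unions) (auto simp: High_def)
  also have "card (nbhd G x \<union> nbhd G u) = card (nbhd G x) + card (nbhd G u - nbhd G x)"
    by (subst card_Un_disjoint[symmetric]) auto
  finally show "n \<le> 2 * card (insert u (nbhd G u - nbhd G x)) + 2 * card (nbhd G x)"
    by (simp add: card_insert_if)
qed

text \<open>A vertex undominated by \<open>X\<close> is not adjacent to \<open>x\<close>, hence is
  high, and \<open>High_far\<close> yields \<open>many\<close>. \<open>X\<close> is a clique, and
  \<open>reach\<close> says that it touches every component of the high vertices.\<close>

lemma domination_Low:
  assumes X: "X \<subseteq> Low" "x \<in> X"
    and reach: "\<And>w. w \<in> High \<Longrightarrow> \<exists>v\<in>X. \<exists>a \<in> nbhd G v \<inter> High. (a, w) \<in> rtrancl_on High (parcs G)"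
  shows "domination G X High x"
proof
  show "x \<in> X" "X \<subseteq> pverts G" "High \<subseteq> pverts G" using X Low_verts High_verts by auto
  show conn: "(x, v) \<in> rtrancl_on X (parcs G)" if v: "v \<in> X" for v
  proof (cases "v = x")
    case False
    then have "(x, v) \<in> parcs G" using Low_adjacent[of x v] X v by (auto simp: nbhd_iff)
    then show ?thesis using rtrancl_on_into_rtrancl_on[OF rtrancl_on_refl[OF X(2)]] v by blast
  qed (use v in simp)
  show "(x, w) \<in> rtrancl_on (High \<union> X) (parcs G)" if w: "w \<in> High" for w
  proof -
    obtain v a where v: "v \<in> X" "a \<in> nbhd G v" "a \<in> High" "(a, w) \<in> rtrancl_on High (parcs G)"
      using reach[OF w] by blast
    have "(x, v) \<in> rtrancl_on (High \<union> X) (parcs G)"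
      using rtrancl_on_mono[OF order_refl _ conn[OF v(1)]] by blast
    then have "(x, a) \<in> rtrancl_on (High \<union> X) (parcs G)"
      by (rule rtrancl_on_into_rtrancl_on) (use v in \<open>auto simp: nbhd_iff\<close>)
    moreover have "(a, w) \<in> rtrancl_on (High \<union> X) (parcs G)"
      using rtrancl_on_mono[OF order_refl _ v(4)] by blast
    ultimately show ?thesis by (rule rtrancl_on_trans)
  qed
  have undom: "z \<in> High" "z \<notin> nbhd G x" if "z \<in> undom X" for z
  proof -
    show "z \<notin> nbhd G x" using that X nbhd_commute by (auto simp: undom_def)
    moreover have "z \<noteq> x" using that X by (auto simp: undom_def)
    ultimately show "z \<in> High" using Low_adjacent[of x z] that X by (auto simp: undom_def High_def)
  qed
  then show "undom X \<subseteq> High" by blast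
  show "card (pverts G) \<le> 4 * card (insert z (nbhd G z) \<inter> High)" if z: "z \<in> undom X" for z
  proof -
    have xL: "x \<in> Low" using X by blast
    note far = High_far[OF xL undom[OF z]]
    have "card (insert z (nbhd G z - nbhd G x)) \<le> card (insert z (nbhd G z) \<inter> High)"
      using far(1) undom[OF z] by (intro card_mono) auto
    moreover have "4 * card (nbhd G x) + 2 < n" using xL by (simp add: Low_def)
    ultimately show ?thesis using far(2) n by linarith
  qed
qed

text \<open>The starting tree is the full star at \<open>x\<close>, which has at least
  \<open>2 * k >= k + 1\<close> leaves.\<close>

lemma ST_if_one_connector:
  assumes x: "x \<in> Low"
    and reach: "\<And>w. w \<in> High \<Longrightarrow> \<exists>a \<in> nbhd G x \<inter> High. (a, w) \<in> rtrancl_on High (parcs G)"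
  shows "\<exists>T. is_2k_ST k T G"
proof -
  interpret domination G "{x}" High x
    by (rule domination_Low) (use assms in auto)
  let ?A = "insert x (nbhd G x)" and ?p = "\<lambda>_. x"
  have xV: "x \<in> pverts G" using x Low_verts by blast
  have "ptree {x} x ?p ?A"
    by (rule ptreeI[where h = "\<lambda>v. if v = x then 0 else 1"])
      (use xV nbhd_subset nbhd_commute in auto)
  moreover have "children ?A x ?p x = nbhd G x" by (auto simp: children_def)
  then have "tdeg ?A x ?p x \<ge> k + 1" using min_deg[OF xV] k by (simp add: tdeg_def)
  ultimately show ?thesis
    using High_degree num k by (intro exists_2k_ST[of k ?p ?A "{x}"]) (auto simp: n)
qed

text \<open>
  Both \<open>x\<close> and \<open>y\<close> are adjacent to all of \<open>Q\<close>, which is split so that each of them gets at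
  least \<open>k + 1\<close> neighbours in the tree; here \<open>2 * k\<close> is exactly what is needed.
\<close>
lemma ST_if_two_connectors:
  assumes x: "x \<in> Low" and y: "y \<in> Low" and xy: "x \<noteq> y"
    and reach: "\<And>w. w \<in> High \<Longrightarrow> \<exists>v\<in>{x, y}. \<exists>a \<in> nbhd G v \<inter> High. (a, w) \<in> rtrancl_on High (parcs G)"
    and ne: "nbhd G x \<inter> High \<noteq> {}" "nbhd G y \<inter> High \<noteq> {}"
    and disj: "nbhd G x \<inter> nbhd G y \<inter> High = {}"
  shows "\<exists>T. is_2k_ST k T G"
proof -
  interpret domination G "{x, y}" High x
    by (rule domination_Low) (use assms in auto)
  define Q where "Q = Low - {x, y}"
  define Hx where "Hx = nbhd G x \<inter> High"
  define Hy where "Hy = nbhd G y \<inter> High"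
  have fin: "finite Q" "finite Hx" "finite Hy" by (simp_all add: Q_def Hx_def Hy_def)
  have V: "x \<in> pverts G" "y \<in> pverts G" using x y Low_verts by auto
  have notHigh: "x \<notin> High" "y \<notin> High" "Q \<inter> High = {}" using x y by (auto simp: High_def Q_def)
  have QN: "q \<in> nbhd G x" "q \<in> nbhd G y" if "q \<in> Q" for q
    using Low_adjacent[of x q] Low_adjacent[of y q] x y that by (auto simp: Q_def)
  have xyN: "y \<in> nbhd G x" using Low_adjacent[OF x y xy] .
  have nx: "nbhd G x = insert y (Hx \<union> Q)"
    using QN xyN nbhd_subset by (auto simp: Hx_def Q_def High_def)
  have ny: "nbhd G y = insert x (Hy \<union> Q)"
    using QN xyN nbhd_subset nbhd_commute by (auto simp: Hy_def Q_def High_def)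
  have HQ: "Hx \<inter> Q = {}" "Hy \<inter> Q = {}" "y \<notin> Hx" "y \<notin> Q" "x \<notin> Hy" "x \<notin> Q"
    using notHigh by (auto simp: Hx_def Hy_def Q_def)
  have "card (nbhd G x) = Suc (card Hx + card Q)" "card (nbhd G y) = Suc (card Hy + card Q)"
    unfolding nx ny using fin HQ by (simp_all add: card_Un_disjoint)
  moreover have "card Hx \<ge> 1" "card Hy \<ge> 1"
    using ne fin by (simp_all add: Hx_def Hy_def Suc_le_eq card_gt_0_iff)
  \<comment> \<open>\<open>card Hx + card Q >= 2 * k - 1\<close> and \<open>card Hy >= 1\<close>
    together provide the \<open>2 * k\<close> neighbours needed besides the edge \<open>xy\<close>.
    Truncation handles the case that \<open>Hx\<close> or \<open>Hy\<close> alone has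
    \<open>k\<close> elements.\<close>
  ultimately have q: "k - card Hx \<le> card Q" "k - card Hy \<le> card Q - (k - card Hx)"
    using min_deg[OF V(1)] min_deg[OF V(2)] k by linarith+
  obtain Qx where Qx: "Qx \<subseteq> Q" "card Qx = k - card Hx"
    using obtain_subset_with_card_n[OF q(1)] by blast
  have Qy: "card (Q - Qx) \<ge> k - card Hy"
    using q(2) Qx fin by (simp add: card_Diff_subset finite_subset)
  define Cx where "Cx = insert y (Hx \<union> Qx)"
  define Cy where "Cy = Hy \<union> (Q - Qx)"
  have C: "Cx \<subseteq> nbhd G x" "Cy \<subseteq> nbhd G y" "x \<notin> Cx" "x \<notin> Cy" "Cx \<inter> Cy = {}" "y \<in> Cx"
    using nx ny Qx notHigh disj by (auto simp: Cx_def Cy_def Hx_def Hy_def Q_def)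
  \<comment> \<open>\<open>y\<close> is a child of the root \<open>x\<close>, so the edge
    \<open>xy\<close> counts for both degrees.\<close>
  let ?A = "insert x (Cx \<union> Cy)" and ?p = "\<lambda>v. if v \<in> Cy then y else x"
  have "ptree {x, y} x ?p ?A"
  proof (rule ptreeI[where h = "\<lambda>v. if v = x then 0 else if v \<in> Cy then 2 else 1"])
    show "?A \<subseteq> pverts G" using C V nbhd_subset by blast
    fix v assume "v \<in> ?A" "v \<noteq> x"
    then show "?p v \<in> ?A \<inter> {x, y} \<inter> nbhd G v" using C nbhd_commute by auto
    show "(if ?p v = x then 0 else if ?p v \<in> Cy then 2 else 1) < (if v = x then 0 else if v \<in> Cy then 2 else (1::nat))"
      using \<open>v \<noteq> x\<close> C xy by auto
  qed (use C in auto)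
  moreover have "tdeg ?A x ?p v \<ge> k + 1" if "v \<in> {x, y}" for v
  proof (cases "v = x")
    case True
    have "children ?A x ?p x = Cx" using C xy by (auto simp: children_def)
    moreover have "card Cx = Suc (card Hx + card Qx)"
    proof -
      have "Hx \<inter> Qx = {}" "y \<notin> Qx" using HQ Qx(1) by auto
      then show ?thesis
        unfolding Cx_def using fin HQ finite_subset[OF Qx(1) fin(1)] by (simp add: card_Un_disjoint)
    qed
    ultimately show ?thesis using True Qx(2) by (simp add: tdeg_def)
  next
    case False
    then have v: "v = y" using that by simp
    have "children ?A x ?p y = Cy" using C xy by (auto simp: children_def)
    moreover have "card Cy = card Hy + card (Q - Qx)"
      unfolding Cy_def using fin HQ by (intro card_Un_disjoint) auto
    ultimately show ?thesis using v xy Qy by (simp add: tdeg_def)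
  qed
  ultimately show ?thesis
    using High_degree num k xy by (intro exists_2k_ST[of k ?p ?A "{x, y}"]) (auto simp: n)
qed

section \<open>Components of the graph induced on the high vertices\<close>

definition comp :: "'a \<Rightarrow> 'a set" where
  "comp a = {v. (a, v) \<in> rtrancl_on High (parcs G)}"

text \<open>These are the nonempty unions of components of the graph induced on
  \<open>High\<close>.\<close>

definition closed_in_High :: "'a set \<Rightarrow> bool" where
  "closed_in_High C \<longleftrightarrow> C \<noteq> {} \<and> C \<subseteq> High \<and> (\<forall>u\<in>C. nbhd G u \<inter> High \<subseteq> C)"

lemma rtrancl_on_High_sym:
  assumes "(u, v) \<in> rtrancl_on High (parcs G)"
  shows "(v, u) \<in> rtrancl_on High (parcs G)"
proof -
  have "sym (parcs G)" by (rule symI) (rule arcs_symmetric)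
  then show ?thesis using assms by (rule symD[OF rtrancl_on_sym])
qed

lemma closed_comp:
  assumes "a \<in> High"
  shows "closed_in_High (comp a)"
  unfolding closed_in_High_def
proof (intro conjI ballI subsetI)
  show "comp a \<noteq> {}" using rtrancl_on_refl[OF assms] by (auto simp: comp_def)
  show "v \<in> High" if "v \<in> comp a" for v
    using in_rtrancl_on_in_F(2) that by (simp add: comp_def)
  show "v \<in> comp a" if "u \<in> comp a" "v \<in> nbhd G u \<inter> High" for u v
    using rtrancl_on_into_rtrancl_on[of a u High "parcs G" v] that by (simp add: comp_def nbhd_iff)
qed

lemma comp_reach:
  assumes "u \<in> comp a" "v \<in> comp a"
  shows "(u, v) \<in> rtrancl_on High (parcs G)"
  using rtrancl_on_trans[OF rtrancl_on_High_sym[of a u], of v] assms by (simp add: comp_def)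

lemma comp_disjoint:
  assumes "b \<notin> comp a"
  shows "comp a \<inter> comp b = {}"
proof (rule ccontr)
  assume "comp a \<inter> comp b \<noteq> {}"
  then obtain v where "(a, v) \<in> rtrancl_on High (parcs G)" "(b, v) \<in> rtrancl_on High (parcs G)"
    by (auto simp: comp_def)
  then have "(a, b) \<in> rtrancl_on High (parcs G)"
    using rtrancl_on_trans[of a v] rtrancl_on_High_sym[of b v] by blast
  then have "b \<in> comp a" by (simp add: comp_def)
  with assms show False by contradiction
qed

text \<open>If \<open>C\<close> lay inside the neighbourhood of \<open>x\<close>, any
  \<open>u\<close> in \<open>C\<close> would have all its neighbours in the closed neighbourhood of
  \<open>x\<close> minus \<open>u\<close>, making its degree at most that of the low vertex
  \<open>x\<close>. So some \<open>u\<close> in \<open>C\<close> is not adjacent to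
  \<open>x\<close>, and \<open>High_far\<close> applies to it.\<close>

lemma closed_far_from_Low:
  assumes C: "closed_in_High C" and x: "x \<in> Low"
  shows "\<exists>F \<subseteq> C - nbhd G x. n \<le> 2 * card F + 2 * card (nbhd G x)"
proof -
  have CH: "C \<subseteq> High" and cl: "\<And>u. u \<in> C \<Longrightarrow> nbhd G u \<inter> High \<subseteq> C"
    using C by (auto simp: closed_in_High_def)
  have "\<not> C \<subseteq> nbhd G x"
  proof
    assume sub: "C \<subseteq> nbhd G x"
    obtain u where u: "u \<in> C" using C by (auto simp: closed_in_High_def)
    have "nbhd G u \<subseteq> (C \<union> Low) - {u}"
      using cl[OF u] nbhd_subset nbhd_irrefl by (auto simp: High_def)
    also have "\<dots> \<subseteq> insert x (nbhd G x) - {u}" using sub Low_adjacent[OF x] by auto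
    finally have "card (nbhd G u) \<le> card (insert x (nbhd G x) - {u})" by (intro card_mono) auto
    also have "\<dots> = card (nbhd G x)"
      using u sub card_Diff_singleton[of u "insert x (nbhd G x)"] by auto
    finally show False using u CH x nbhd_subset by (auto simp: Low_def High_def)
  qed
  then obtain u where u: "u \<in> C" "u \<notin> nbhd G x" by blast
  then have uH: "u \<in> High" using CH by blast
  have "insert u (nbhd G u - nbhd G x) \<subseteq> C - nbhd G x"
    using High_far(1)[OF x uH u(2)] cl[OF u(1)] u by auto
  then show ?thesis using High_far(2)[OF x uH u(2)] by blast
qed

text \<open>With \<open>d\<close> the degree of \<open>x\<close>, three disjoint sets would put
  \<open>3 * (n / 2 - d)\<close> vertices outside its closed neighbourhood of size
  \<open>d + 1\<close>. Fitting into \<open>n\<close> vertices needs \<open>4 * d >= n + 2\<close>,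
  but \<open>x\<close> is low.\<close>

lemma no_three_closed:
  assumes x: "x \<in> Low" and C: "closed_in_High A" "closed_in_High B" "closed_in_High C"
  shows "A \<inter> B \<noteq> {} \<or> A \<inter> C \<noteq> {} \<or> B \<inter> C \<noteq> {}"
proof (rule ccontr)
  assume "\<not> ?thesis"
  then have disj: "A \<inter> B = {}" "A \<inter> C = {}" "B \<inter> C = {}" by simp_all
  obtain FA where FA: "FA \<subseteq> A - nbhd G x" "n \<le> 2 * card FA + 2 * card (nbhd G x)"
    using closed_far_from_Low[OF C(1) x] by blast
  obtain FB where FB: "FB \<subseteq> B - nbhd G x" "n \<le> 2 * card FB + 2 * card (nbhd G x)"
    using closed_far_from_Low[OF C(2) x] by blast
  obtain FC where FC: "FC \<subseteq> C - nbhd G x" "n \<le> 2 * card FC + 2 * card (nbhd G x)"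
    using closed_far_from_Low[OF C(3) x] by blast
  have sub: "FA \<subseteq> High" "FB \<subseteq> High" "FC \<subseteq> High"
    using FA FB FC C by (auto simp: closed_in_High_def)
  then have fin: "finite FA" "finite FB" "finite FC" using finite_subset finite_High by blast+
  have "card (FA \<union> FB \<union> FC) = card FA + card FB + card FC"
  proof -
    have "FA \<inter> FB = {}" "(FA \<union> FB) \<inter> FC = {}" using FA FB FC disj by blast+
    then show ?thesis using fin by (simp add: card_Un_disjoint)
  qed
  moreover have "card (FA \<union> FB \<union> FC \<union> insert x (nbhd G x)) =
      card (FA \<union> FB \<union> FC) + card (insert x (nbhd G x))"
  proof (rule card_Un_disjoint)
    show "(FA \<union> FB \<union> FC) \<inter> insert x (nbhd G x) = {}"
      using FA FB FC sub x by (auto simp: High_def)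
  qed (use fin in auto)
  moreover have "card (FA \<union> FB \<union> FC \<union> insert x (nbhd G x)) \<le> n"
    unfolding n using sub x High_verts Low_verts nbhd_subset by (intro card_mono) auto
  moreover have "card (insert x (nbhd G x)) = Suc (card (nbhd G x))" by simp
  moreover have "4 * card (nbhd G x) + 2 < n" using x by (simp add: Low_def)
  ultimately show False using FA(2) FB(2) FC(2) by linarith
qed

lemma closed_touches_Low:
  assumes C: "closed_in_High C" and x: "x \<in> Low"
  shows "\<exists>y\<in>Low. nbhd G y \<inter> C \<noteq> {}"
proof -
  obtain a where a: "a \<in> C" using C by (auto simp: closed_in_High_def)
  have CH: "C \<subseteq> High" using C by (simp add: closed_in_High_def)
  have "(a, x) \<in> rtrancl_on (pverts G) (parcs G)"
    using a CH x High_verts Low_verts by (intro connected) auto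
  moreover have "x \<notin> C" using CH x by (auto simp: High_def)
  ultimately obtain u v where uv: "(u, v) \<in> parcs G" "u \<in> pverts G \<inter> C" "v \<in> pverts G - C"
    using rtrancl_on_crossing[OF _ a] by blast
  then have "v \<in> nbhd G u" "u \<in> nbhd G v" by (auto simp: nbhd_iff arcs_symmetric)
  moreover from this have "v \<in> Low" using uv C by (auto simp: closed_in_High_def High_def)
  ultimately show ?thesis using uv by blast
qed

lemma ST_if_Low_nonempty:
  assumes x0: "x0 \<in> Low"
  shows "\<exists>T. is_2k_ST k T G"
\<comment> \<open>The condition holds vacuously if \<open>High\<close> is empty, so its failure
  supplies a high vertex.\<close>
proof (cases "\<exists>x\<in>Low. \<forall>w\<in>High. \<exists>a \<in> nbhd G x \<inter> High. (a, w) \<in> rtrancl_on High (parcs G)")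
  case True
  then obtain x where "x \<in> Low" "\<And>w. w \<in> High \<Longrightarrow> \<exists>a \<in> nbhd G x \<inter> High. (a, w) \<in> rtrancl_on High (parcs G)"
    by blast
  then show ?thesis by (rule ST_if_one_connector)
next
  case none: False
  have reach: "\<exists>a' \<in> nbhd G x \<inter> High. (a', w) \<in> rtrancl_on High (parcs G)"
    if "a \<in> High" "nbhd G x \<inter> comp a \<noteq> {}" "w \<in> comp a" for x a w
  proof -
    from that(2) obtain a' where "a' \<in> nbhd G x" "a' \<in> comp a" by blast
    then show ?thesis using comp_reach[of a' a w] closed_comp[OF that(1)] that(3)
      by (auto simp: closed_in_High_def)
  qed
  have self: "a \<in> comp a" if "a \<in> High" for a using rtrancl_on_refl[OF that] by (simp add: comp_def)
  obtain a where a: "a \<in> High" using none x0 by blast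
  note clA = closed_comp[OF a]
  obtain x where x: "x \<in> Low" "nbhd G x \<inter> comp a \<noteq> {}" using closed_touches_Low[OF clA x0] by blast
  \<comment> \<open>\<open>x\<close> reaches all of \<open>comp a\<close> but, by
    \<open>none\<close>, not all of \<open>High\<close>; a second component exists.\<close>
  obtain b where b: "b \<in> High" "b \<notin> comp a" using none x reach[OF a x(2)] by blast
  note clB = closed_comp[OF b(1)]
  obtain y where y: "y \<in> Low" "nbhd G y \<inter> comp b \<noteq> {}" using closed_touches_Low[OF clB x0] by blast
  have cover: "w \<in> comp a \<or> w \<in> comp b" if "w \<in> High" for w
    using no_three_closed[OF x0 clA clB closed_comp[OF that]] comp_disjoint that b(2) by blast
  \<comment> \<open>A low vertex meeting both components would be a connector by itself, against
    \<open>none\<close>. Hence \<open>x\<close> and \<open>y\<close> are distinct and share no high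
    neighbour.\<close>
  have not_both: "\<not> (nbhd G z \<inter> comp a \<noteq> {} \<and> nbhd G z \<inter> comp b \<noteq> {})" if "z \<in> Low" for z
    using none that cover reach[OF a, of z] reach[OF b(1), of z] by blast
  have sub: "comp a \<subseteq> High" "comp b \<subseteq> High" using clA clB by (simp_all add: closed_in_High_def)
  show ?thesis
  proof (rule ST_if_two_connectors[OF x(1) y(1)])
    show "x \<noteq> y" using not_both x y by blast
    show "nbhd G x \<inter> High \<noteq> {}" "nbhd G y \<inter> High \<noteq> {}" using x y sub by blast+
    show "nbhd G x \<inter> nbhd G y \<inter> High = {}" using not_both x y cover by blast
    show "\<exists>v\<in>{x, y}. \<exists>a \<in> nbhd G v \<inter> High. (a, w) \<in> rtrancl_on High (parcs G)" if "w \<in> High" for w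
      using cover[OF that] reach[OF a x(2), of w] reach[OF b(1) y(2), of w] by blast
  qed
qed

lemma ST_if_Low_empty:
  assumes "Low = {}" and v: "v \<in> pverts G"
  shows "\<exists>T. is_2k_ST k T G"
proof -
  have deg: "n \<le> 4 * card (nbhd G u) + 2" if "u \<in> pverts G" for u
    using assms(1) that by (auto simp: Low_def)
  interpret domination G "{v}" "pverts G" v
  proof
    show "(v, x) \<in> rtrancl_on {v} (parcs G)" if "x \<in> {v}" for x using that by simp
    show "(v, w) \<in> rtrancl_on (pverts G \<union> {v}) (parcs G)" if "w \<in> pverts G" for w
      using connected[OF v that] v by (simp add: insert_absorb)
    show "undom {v} \<subseteq> pverts G" by (auto simp: undom_def)
    then show "card (pverts G) \<le> 4 * card (insert z (nbhd G z) \<inter> pverts G)" if "z \<in> undom {v}" for z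
      using deg[of z] that nbhd_subset[of z] by (auto simp: Int_absorb2 n)
  qed (use v in auto)
  have "ptree {v} v (\<lambda>_. v) {v}" by (rule ptreeI) (use v in auto)
  moreover have "(real n - 2) / 4 \<le> real (card (nbhd G u))" if "u \<in> pverts G" for u
    using deg[OF that] by simp
  ultimately show ?thesis
    using num k v by (intro exists_2k_ST[of k "\<lambda>_. v" "{v}" "{}"]) (auto simp: n)
qed

end

theorem theorem1p6:
  fixes k n :: nat and G :: "'a pair_pre_digraph"
  assumes "k \<ge> 2"
    and "pair_graph G"
    and "Digraph_Component.connected (with_proj G)"
    and "n = card (pverts G)"
    and "n \<ge> n1 k"
    and "min_degree G \<ge> 2 * k"
    and "\<not> complete_graph G"
    and "real (NC G) \<ge> (real n - 2) / 2"
  shows "\<exists>T. is_2k_ST k T G"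
proof -
  interpret pair_graph G by fact
  have ne: "pverts G \<noteq> {}" using assms(3) by (simp add: connected_conv)
  \<comment> \<open>Connectedness in the library is stated for the symmetric closure of the
    arcs.\<close>
  have sym: "(parcs G)\<^sup>s = parcs G"
    using arcs_symmetric by (auto simp: symcl_def)
  interpret large_unions G k n
  proof
    show "(u, v) \<in> rtrancl_on (pverts G) (parcs G)" if "u \<in> pverts G" "v \<in> pverts G" for u v
      using assms(3) that by (simp add: connected_conv sym)
    show "2 * k \<le> card (nbhd G v)" if "v \<in> pverts G" for v
    proof -
      have "min_degree G \<le> degree G v"
        unfolding min_degree_def using that pair_finite_verts by (intro Min_le) auto
      then show ?thesis using assms(6) by (simp add: degree_eq_card_nbhd)
    qed
    show "n \<le> 2 * card (nbhd G u \<union> nbhd G v) + 2"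
      if "u \<in> pverts G" "v \<in> pverts G" "u \<noteq> v" "v \<notin> nbhd G u" for u v
    proof -
      let ?S = "{card (nbhd G u \<union> nbhd G v) | u v.
        u \<in> pverts G \<and> v \<in> pverts G \<and> u \<noteq> v \<and> (u, v) \<notin> parcs G}"
      have "?S \<subseteq> (\<lambda>(u, v). card (nbhd G u \<union> nbhd G v)) ` (pverts G \<times> pverts G)" by auto
      then have "finite ?S" using pair_finite_verts by (meson finite_SigmaI finite_imageI finite_subset)
      moreover have "card (nbhd G u \<union> nbhd G v) \<in> ?S" using that by (auto simp: nbhd_iff)
      ultimately have "NC G \<le> card (nbhd G u \<union> nbhd G v)" unfolding NC_def by (rule Min_le)
      then have "real (NC G) \<le> real (card (nbhd G u \<union> nbhd G v))" by simp
      with assms(8) have "real n \<le> real (2 * card (nbhd G u \<union> nbhd G v) + 2)" by simp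
      then show ?thesis by (simp only: of_nat_le_iff)
    qed
    show "real k * (11 + 4 * ln n) < (real n - 2) / 4"
      by (rule log_bound_of_n1) fact+
  qed fact+
  show ?thesis using ne ST_if_Low_nonempty ST_if_Low_empty by blast
qed

end
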